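(* Let $a,b\ge 0$ with at least one of $a,b$ nonzero, and let $z,\zeta\in\mathbb{C}$ with $\operatorname{Re} z>1$ and $\operatorname{Re}\zeta>1$. Then the complex exponential B-spline $E_{(z,\zeta)}^{(a,b)}:=E_z^a*E_\zeta^b$ has the time domain representation $$E_{(z,\zeta)}^{(a,b)}(x)=\frac{1}{\Gamma(z+\zeta)}\sum_{k=0}^\infty\left[\sum_{\ell=0}^k\binom{z}{\ell}\binom{\zeta}{k-\ell}e^{-\ell(a-b)}\right](-1)^k e^{-bx}\,M\bigl(z,z+\zeta;-(a-b)(x-k)\bigr)\,(x-k)_+^{z+\zeta-1},\qquad x\in\mathbb{R}.$$
   Context: The Fourier transform is $\widehat f(\omega)=\int_{\mathbb{R}} f(x)e^{-i\omega x}\,dx$ (extended to $L^2(\mathbb{R})$). For $a\ge 0$ and $\operatorname{Re} z>1$ the complex exponential B-spline $E_z^a$ is defined in the Fourier domain by $\widehat{E_z^a}(\omega):=\left(\frac{1-e^{-(a+i\omega)}}{a+i\omega}\right)^z$, where the power is taken on the principal branch of the logarithm (the values of the base avoid the negative real axis), $0^z:=0$, and the base is extended continuously by $1$ at $\omega=0$ when $a=0$. $*$ denotes convolution on $\mathbb{R}$. The complex binomial is $\binom{z}{\ell}=\frac{\Gamma(z+1)}{\Gamma(\ell+1)\Gamma(z-\ell+1)}$ (with $1/\Gamma=0$ at the poles of $\Gamma$). The truncated power is $x_+^{w}=e^{w\ln x}$ for $x>0$ and $x_+^{w}=0$ for $x\le 0$. $M(\alpha,\beta;t)=\sum_{m=0}^\infty\frac{(\alpha)_m}{(\beta)_m}\frac{t^m}{m!}$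 is Kummer's confluent hypergeometric function. *)

theory Defs
  imports "HOL-Analysis.Analysis"
begin

definition square_integrable :: "(real \<Rightarrow> complex) \<Rightarrow> bool" where
  "square_integrable f \<longleftrightarrow>
     f \<in> borel_measurable lborel \<and> integrable lborel (\<lambda>x. (cmod (f x))\<^sup>2)"

definition fourier_integral :: "(real \<Rightarrow> complex) \<Rightarrow> real \<Rightarrow> complex" where
  "fourier_integral f \<omega> =
     (LINT x|lborel. f x * exp (- (\<i> * complex_of_real \<omega> * complex_of_real x)))"

(* Convergence in L^2. The nonnegative integral is used because it is \<infinity>, rather than a
   default value 0, when the difference is not square-integrable. *)
definition L2_converges :: "(nat \<Rightarrow> real \<Rightarrow> complex) \<Rightarrow> (real \<Rightarrow> complex) \<Rightarrow> bool" where
  "L2_converges u f \<longleftrightarrow>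
     (\<lambda>n. \<integral>\<^sup>+ x. ennreal ((cmod (u n x - f x))\<^sup>2) \<partial>lborel) \<longlonglongrightarrow> 0"

(* F represents the Fourier transform of f in L^2: the extension of fourier_integral by
   continuity from the dense subspace of functions that are both integrable and
   square-integrable. It is a relation because f and F matter only up to null sets. *)
definition has_L2_fourier :: "(real \<Rightarrow> complex) \<Rightarrow> (real \<Rightarrow> complex) \<Rightarrow> bool" where
  "has_L2_fourier f F \<longleftrightarrow>
     square_integrable f \<and> square_integrable F \<and>
     (\<exists>u. (\<forall>n. integrable lborel (u n) \<and> square_integrable (u n)) \<and>
          L2_converges u f \<and> L2_converges (\<lambda>n. fourier_integral (u n)) F)"

definition exp_spline_base :: "real \<Rightarrow> real \<Rightarrow> complex" where
  "exp_spline_base a \<omega> =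
     (if a = 0 \<and> \<omega> = 0 then 1
      else (1 - exp (- (complex_of_real a + \<i> * complex_of_real \<omega>)))
             / (complex_of_real a + \<i> * complex_of_real \<omega>))"

(* A representative of the L^2 class with the prescribed Fourier transform. Complex powr
   is the principal power, with 0 powr z = 0. *)
definition exp_Bspline :: "real \<Rightarrow> complex \<Rightarrow> real \<Rightarrow> complex" where
  "exp_Bspline a z = (SOME f. has_L2_fourier f (\<lambda>\<omega>. exp_spline_base a \<omega> powr z))"

(* Pointwise meaningful for square-integrable functions, and independent there of the
   choice of representatives. *)
definition convolution :: "(real \<Rightarrow> complex) \<Rightarrow> (real \<Rightarrow> complex) \<Rightarrow> real \<Rightarrow> complex" where
  "convolution f g x = (LINT y|lborel. f y * g (x - y))"

definition exp_Bspline2 :: "real \<Rightarrow> real \<Rightarrow> complex \<Rightarrow> complex \<Rightarrow> real \<Rightarrow> complex" where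
  "exp_Bspline2 a b z \<zeta> = convolution (exp_Bspline a z) (exp_Bspline b \<zeta>)"

(* rGamma is the entire function 1/Gamma, which vanishes at the poles of Gamma. *)
definition complex_binomial :: "complex \<Rightarrow> nat \<Rightarrow> complex" where
  "complex_binomial z l = Gamma (z + 1) * rGamma (of_nat l + 1) * rGamma (z - of_nat l + 1)"

definition truncated_power :: "real \<Rightarrow> complex \<Rightarrow> complex" where
  "truncated_power x w = (if x > 0 then exp (w * complex_of_real (ln x)) else 0)"

definition kummer_M :: "complex \<Rightarrow> complex \<Rightarrow> complex \<Rightarrow> complex" where
  "kummer_M \<alpha> \<beta> t = (\<Sum>m. pochhammer \<alpha> m / pochhammer \<beta> m * (t ^ m / fact m))"

end

theory Submission
  imports Defs "HOL-Probability.Characteristic_Functions" "HOL-Probability.Sinc_Integral"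
begin

text \<open>
  Put \<open>s = a + \<i> \<omega>\<close>. For \<open>a > 0\<close> both \<open>1 - exp (- s)\<close> and \<open>s\<close> lie in the right half-plane, so the
  principal power splits as \<open>(1 - exp (- s)) powr z * s powr (- z)\<close>. The binomial series
  of the first factor, in powers of \<open>exp (- s)\<close>, stands for translations by integers, and
  \<open>s powr (- z)\<close> is the transform of \<open>exp (- a x)\<close> times a truncated power, divided by \<open>Gamma z\<close>.
  Hence the spline should be the function \<open>exp_spline a z\<close>, namely \<open>exp (- a x) / Gamma z\<close>
  times the sum of \<open>(-1)^l * (z gchoose l)\<close> times the truncated power of \<open>x - l\<close> with exponent
  \<open>z - 1\<close>. This is \<open>exp_spline_fourier\<close>; it rests on the Laplace transform
  \<open>truncated_power_laplace\<close>.

  The spline is given as some \<open>L\<^sup>2\<close> function with the prescribed transform, so \<open>exp_spline\<close> has to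
  be square-integrable with that transform, and the transform has to determine a function up to null
  sets. Both follow from one half of Plancherel's theorem, \<open>plancherel_inequality\<close>: the \<open>L\<^sup>2\<close> norm
  of an integrable function is bounded by that of its transform. Uniqueness
  (\<open>has_L2_fourier_unique\<close>) is then immediate. For existence (\<open>exp_spline_has_L2_fourier\<close>), including
  the case \<open>a = 0\<close> where the terms of the series grow at infinity, the parameter is replaced by
  \<open>a + 1 / n\<close>; the transforms stay below a fixed square-integrable function, which bounds the \<open>L\<^sup>2\<close>
  norms, and the limit is taken by Fatou's lemma and dominated convergence.

  The convolution integral does not see null sets, so the splines may be replaced by
  \<open>exp_spline a z\<close> and \<open>exp_spline b \<zeta>\<close>. For fixed \<open>x\<close> only finitely many terms matter. The product of
  the terms with indices \<open>l\<close> and \<open>m\<close> integrates to a beta integral with an exponential weight,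
  which \<open>kummer_integral\<close> evaluates as a Kummer function of \<open>x - (l + m)\<close>, with the additional factor
  \<open>exp (- l (a - b))\<close> caused by the shift by \<open>l\<close>. Collecting the terms with \<open>l + m = k\<close> gives the claim.
\<close>


section \<open>Continuity of translation in the mean\<close>

lemma integrable_translate:
  fixes f :: "real \<Rightarrow> 'a::{banach, second_countable_topology}"
  assumes "integrable lborel f"
  shows "integrable lborel (\<lambda>x. f (x + t))"
  using lborel_integrable_real_affine[OF assms, of 1 t] by (simp add: add.commute)

lemma integral_translate:
  fixes f :: "real \<Rightarrow> 'a::{banach, second_countable_topology}"
  shows "(\<integral>x. f (x + t) \<partial>lborel) = (\<integral>x. f x \<partial>lborel)"
  using lborel_integral_real_affine[of 1 f t] by (simp add: add.commute)

text \<open>At a boundary point of \<open>U\<close> the translated indicators need not converge, but points inside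
  an open set stay inside under small translations. Since a translate of \<open>U\<close> has the same measure
  as \<open>U\<close>, the mass gained equals the mass lost, and only the loss has to be estimated.\<close>

lemma L1_translation_open:
  fixes U :: "real set" and t :: "nat \<Rightarrow> real"
  assumes "open U" and fin: "emeasure lborel U < \<infinity>" and t: "t \<longlonglongrightarrow> 0"
  shows "(\<lambda>n. \<integral>x. \<bar>indicat_real U (x + t n) - indicat_real U x\<bar> \<partial>lborel) \<longlonglongrightarrow> 0"
proof -
  have [measurable]: "U \<in> sets borel" using assms by auto
  have int: "integrable lborel (indicat_real U)"
    using fin by (intro integrable_real_indicator) auto
  note int' = integrable_translate[OF int]
  have int2: "integrable lborel (\<lambda>x. indicat_real U x * (1 - indicat_real U (x + s)))" for s
    by (rule Bochner_Integration.integrable_bound[OF int]) (auto simp: indicator_def)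
  have "(\<lambda>n. \<integral>x. indicat_real U x * (1 - indicat_real U (x + t n)) \<partial>lborel)
          \<longlonglongrightarrow> (\<integral>x. 0 \<partial>(lborel :: real measure))"
  proof (rule integral_dominated_convergence[where w = "indicat_real U"])
    show "AE x in lborel. (\<lambda>n. indicat_real U x * (1 - indicat_real U (x + t n))) \<longlonglongrightarrow> 0"
    proof (rule AE_I2)
      fix x
      show "(\<lambda>n. indicat_real U x * (1 - indicat_real U (x + t n))) \<longlonglongrightarrow> 0"
      proof (cases "x \<in> U")
        case True
        have "(\<lambda>n. x + t n) \<longlonglongrightarrow> x" using tendsto_add[OF tendsto_const t, of x] by simp
        then have "\<forall>\<^sub>F n in sequentially. x + t n \<in> U"
          using \<open>open U\<close> True by (rule topological_tendstoD)
        then show ?thesis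
          by (intro tendsto_eventually) (rule eventually_mono, assumption, simp)
      qed auto
    qed
  qed (use int in \<open>auto simp: indicator_def\<close>)
  moreover have "(\<integral>x. \<bar>indicat_real U (x + s) - indicat_real U x\<bar> \<partial>lborel)
      = 2 * (\<integral>x. indicat_real U x * (1 - indicat_real U (x + s)) \<partial>lborel)" for s
  proof -
    have "(\<integral>x. \<bar>indicat_real U (x + s) - indicat_real U x\<bar> \<partial>lborel)
      = (\<integral>x. 2 * (indicat_real U x * (1 - indicat_real U (x + s)))
          + (indicat_real U (x + s) - indicat_real U x) \<partial>lborel)"
      by (intro Bochner_Integration.integral_cong) (auto simp: indicator_def)
    also have "\<dots> = 2 * (\<integral>x. indicat_real U x * (1 - indicat_real U (x + s)) \<partial>lborel)
       + ((\<integral>x. indicat_real U (x + s) \<partial>lborel) - (\<integral>x. indicat_real U x \<partial>lborel))"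
      using int int' int2 by simp
    finally show ?thesis by (simp only: integral_translate)
  qed
  ultimately show ?thesis by (simp add: tendsto_mult_right_zero)
qed

text \<open>Outer regularity: \<open>A\<close> is replaced by an open superset of nearly the same measure.\<close>

lemma L1_translation_indicator:
  fixes A :: "real set" and t :: "nat \<Rightarrow> real"
  assumes [measurable]: "A \<in> sets borel" and fin: "emeasure lborel A < \<infinity>" and t: "t \<longlonglongrightarrow> 0"
  shows "(\<lambda>n. \<integral>x. \<bar>indicat_real A (x + t n) - indicat_real A x\<bar> \<partial>lborel) \<longlonglongrightarrow> 0"
proof (rule LIMSEQ_I)
  fix e :: real assume e: "0 < e"
  obtain U where U: "open U" "A \<subseteq> U" "emeasure lborel (U - A) < ennreal (e/4)"
    using outer_regular_lborel[of A "e/4"] e by auto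
  have [measurable]: "U \<in> sets borel" using U by auto
  have finD: "emeasure lborel (U - A) < \<infinity>"
    using U(3) by (metis ennreal_less_top infinity_ennreal_def less_trans)
  have "emeasure lborel U = emeasure lborel A + emeasure lborel (U - A)"
    using U(2) by (subst plus_emeasure) (auto simp: Un_absorb1)
  then have finU: "emeasure lborel U < \<infinity>" using fin finD by simp
  have intU: "integrable lborel (indicat_real U)" and intA: "integrable lborel (indicat_real A)"
    and intD: "integrable lborel (indicat_real (U - A))"
    using fin finU finD by (auto intro!: integrable_real_indicator)
  have D: "(\<integral>x. indicat_real (U - A) x \<partial>lborel) < e/4"
    using U(3) finD e by (simp add: emeasure_eq_ennreal_measure ennreal_less_iff)
  obtain N where N: "\<And>n. n \<ge> N \<Longrightarrow>
      \<bar>\<integral>x. \<bar>indicat_real U (x + t n) - indicat_real U x\<bar> \<partial>lborel\<bar> < e/2"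
    using LIMSEQ_D[OF L1_translation_open[OF U(1) finU t], of "e/2"] e by auto
  have "norm ((\<integral>x. \<bar>indicat_real A (x + t n) - indicat_real A x\<bar> \<partial>lborel) - 0) < e" if "n \<ge> N" for n
  proof -
    have "(\<integral>x. \<bar>indicat_real A (x + t n) - indicat_real A x\<bar> \<partial>lborel)
      \<le> (\<integral>x. \<bar>indicat_real U (x + t n) - indicat_real U x\<bar>
             + (indicat_real (U - A) (x + t n) + indicat_real (U - A) x) \<partial>lborel)"
      using intU intA intD U(2)
      by (intro integral_mono Bochner_Integration.integrable_add Bochner_Integration.integrable_abs
            Bochner_Integration.integrable_diff integrable_translate)
         (simp_all, auto simp: indicator_def)
    also have "\<dots> = (\<integral>x. \<bar>indicat_real U (x + t n) - indicat_real U x\<bar> \<partial>lborel)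
        + ((\<integral>x. indicat_real (U - A) (x + t n) \<partial>lborel) + (\<integral>x. indicat_real (U - A) x \<partial>lborel))"
      using intU intD
      by (subst Bochner_Integration.integral_add)
         (auto intro!: Bochner_Integration.integrable_add Bochner_Integration.integrable_abs
            Bochner_Integration.integrable_diff integrable_translate Bochner_Integration.integral_add
            simp del: Bochner_Integration.integral_indicator integrable_indicator_iff)
    also have "\<dots> < e"
      using N[OF that] D unfolding integral_translate[of "indicat_real (U - A)"] by linarith
    finally show ?thesis
      by simp
  qed
  then show "\<exists>N. \<forall>n\<ge>N. norm ((\<integral>x. \<bar>indicat_real A (x + t n) - indicat_real A x\<bar> \<partial>lborel) - 0) < e"
    by blast
qed

lemma L1_translation_continuous:
  fixes f :: "real \<Rightarrow> 'a::{banach, second_countable_topology}" and t :: "nat \<Rightarrow> real"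
  assumes "integrable lborel f" and t: "t \<longlonglongrightarrow> 0"
  shows "(\<lambda>n. \<integral>x. norm (f (x + t n) - f x) \<partial>lborel) \<longlonglongrightarrow> 0"
  using assms(1)
proof (induct rule: integrable_induct)
  case (base A c)
  have "(\<integral>x. norm (indicat_real A (x + t n) *\<^sub>R c - indicat_real A x *\<^sub>R c) \<partial>lborel)
     = (\<integral>x. \<bar>indicat_real A (x + t n) - indicat_real A x\<bar> \<partial>lborel) * norm c" for n
    by (simp flip: scaleR_left_diff_distrib)
  then show ?case
    using tendsto_mult_left_zero[OF L1_translation_indicator[OF _ _ t, of A]] base by simp
next
  case (add f g)
  show ?case
  proof (rule tendsto_sandwich[OF _ _ tendsto_const])
    show "(\<lambda>n. (\<integral>x. norm (f (x + t n) - f x) \<partial>lborel) + (\<integral>x. norm (g (x + t n) - g x) \<partial>lborel)) \<longlonglongrightarrow> 0"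
      using tendsto_add[OF add(2,4)] by simp
    have "(\<integral>x. norm (f (x + t n) + g (x + t n) - (f x + g x)) \<partial>lborel) \<le>
      (\<integral>x. norm (f (x + t n) - f x) + norm (g (x + t n) - g x) \<partial>lborel)" for n
      using add(1,3)
      by (intro integral_mono Bochner_Integration.integrable_add Bochner_Integration.integrable_diff
            integrable_norm integrable_translate norm_diff_triangle_ineq)
    also have "\<dots> n = (\<integral>x. norm (f (x + t n) - f x) \<partial>lborel) + (\<integral>x. norm (g (x + t n) - g x) \<partial>lborel)" for n
      using add(1,3)
      by (intro Bochner_Integration.integral_add Bochner_Integration.integrable_diff
            integrable_norm integrable_translate)
    finally show "\<forall>\<^sub>F n in sequentially. (\<integral>x. norm (f (x + t n) + g (x + t n) - (f x + g x)) \<partial>lborel) \<le>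
       (\<integral>x. norm (f (x + t n) - f x) \<partial>lborel) + (\<integral>x. norm (g (x + t n) - g x) \<partial>lborel)"
      by simp
  qed auto
next
  case (lim f s)
  note int [intro] = lim(1) lim(5)
  have "(\<lambda>i. \<integral>x. norm (s i x - f x) \<partial>lborel) \<longlonglongrightarrow> (\<integral>x. 0 \<partial>(lborel :: real measure))"
  proof (rule integral_dominated_convergence[where w = "\<lambda>x. 3 * norm (f x)"])
    show "AE x in lborel. (\<lambda>i. norm (s i x - f x)) \<longlonglongrightarrow> 0"
      using lim(3) by (auto simp: tendsto_norm_zero_iff LIM_zero_iff)
    show "AE x in lborel. norm (norm (s i x - f x)) \<le> 3 * norm (f x)" for i
    proof (rule AE_I2)
      fix x show "norm (norm (s i x - f x)) \<le> 3 * norm (f x)"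
        using norm_triangle_ineq4[of "s i x" "f x"] lim(4)[of x i] by simp
    qed
  qed (use int in auto)
  then have sf: "(\<lambda>i. \<integral>x. norm (s i x - f x) \<partial>lborel) \<longlonglongrightarrow> 0" by simp
  show ?case
  proof (rule LIMSEQ_I)
    fix e :: real assume e: "0 < e"
    obtain i where i: "\<bar>\<integral>x. norm (s i x - f x) \<partial>lborel\<bar> < e/4"
      using LIMSEQ_D[OF sf, of "e/4"] e by auto
    obtain N where N: "\<And>n. n \<ge> N \<Longrightarrow> \<bar>\<integral>x. norm (s i (x + t n) - s i x) \<partial>lborel\<bar> < e/2"
      using LIMSEQ_D[OF lim(2)[of i], of "e/2"] e by auto
    have "norm ((\<integral>x. norm (f (x + t n) - f x) \<partial>lborel) - 0) < e" if "n \<ge> N" for n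
    proof -
      have "(\<integral>x. norm (f (x + t n) - f x) \<partial>lborel) \<le>
        (\<integral>x. norm (s i (x + t n) - s i x) + (norm (s i (x + t n) - f (x + t n)) + norm (s i x - f x)) \<partial>lborel)"
      proof (intro integral_mono)
        fix x
        have "f (x + t n) - f x = (s i (x + t n) - s i x) - ((s i (x + t n) - f (x + t n)) - (s i x - f x))"
          by simp
        then show "norm (f (x + t n) - f x) \<le> norm (s i (x + t n) - s i x) + (norm (s i (x + t n) - f (x + t n)) + norm (s i x - f x))"
          by (metis norm_triangle_ineq4 norm_triangle_le_diff add_left_mono)
      qed (intro Bochner_Integration.integrable_add Bochner_Integration.integrable_diff
             integrable_norm integrable_translate int)+
      also have "\<dots> = (\<integral>x. norm (s i (x + t n) - s i x) \<partial>lborel) + 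
         ((\<integral>x. norm (s i (x + t n) - f (x + t n)) \<partial>lborel) + (\<integral>x. norm (s i x - f x) \<partial>lborel))"
        using int
        by (subst Bochner_Integration.integral_add)
          (auto intro!: Bochner_Integration.integral_add integrable_translate[of "\<lambda>x. norm (s i x - f x)"]
            Bochner_Integration.integrable_add Bochner_Integration.integrable_diff integrable_norm
            intro: integrable_translate)
      also have "\<dots> < e"
        using N[OF that] i unfolding integral_translate[of "\<lambda>x. norm (s i x - f x)"] by linarith
      finally show ?thesis by simp
    qed
    then show "\<exists>N. \<forall>n\<ge>N. norm ((\<integral>x. norm (f (x + t n) - f x) \<partial>lborel) - 0) < e" by blast
  qed
qed


section \<open>Gaussian means and the Plancherel inequality\<close>

lemma integrable_product_bound:
  fixes F :: "real \<Rightarrow> real \<Rightarrow> complex" and g k :: "real \<Rightarrow> complex"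
  assumes F: "case_prod F \<in> borel_measurable (lborel \<Otimes>\<^sub>M lborel)"
    and g: "integrable lborel g" and k: "integrable lborel k"
    and le: "\<And>x y. norm (F x y) \<le> norm (g x) * norm (k y)"
  shows "integrable (lborel \<Otimes>\<^sub>M lborel) (case_prod F)"
proof (rule Bochner_Integration.integrable_bound[OF _ F])
  have [measurable]: "g \<in> borel_measurable borel" "k \<in> borel_measurable borel"
    using g k by auto
  show "integrable (lborel \<Otimes>\<^sub>M lborel) (\<lambda>p. g (fst p) * k (snd p))"
    by (rule lborel_pair.Fubini_integrable) (use g k in \<open>auto simp: norm_mult\<close>)
  show "AE p in lborel \<Otimes>\<^sub>M lborel. norm (case p of (x, y) \<Rightarrow> F x y) \<le> norm (g (fst p) * k (snd p))"
    using le by (auto simp: norm_mult)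
qed

lemma borel_measurable_cnj [measurable (raw)]:
  assumes "f \<in> borel_measurable M"
  shows "(\<lambda>x. cnj (f x)) \<in> borel_measurable M"
  using assms by (rule measurable_compose) (intro borel_measurable_continuous_onI continuous_intros)

lemma fourier_integral_measurable [measurable]:
  assumes [measurable]: "f \<in> borel_measurable borel"
  shows "fourier_integral f \<in> borel_measurable borel"
  unfolding fourier_integral_def[abs_def] by measurable

lemma norm_fourier_integral_le: "norm (fourier_integral f \<omega>) \<le> (\<integral>x. norm (f x) \<partial>lborel)"
  unfolding fourier_integral_def
  using integral_norm_bound[of lborel "\<lambda>x. f x * exp (- (\<i> * complex_of_real \<omega> * complex_of_real x))"]
  by (simp add: norm_mult)

lemma integrable_std_normal: "integrable lborel std_normal_density"
  using integrable_std_normal_moment[of 0] by simp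

lemma integrable_std_normal_scaled:
  "\<epsilon> \<noteq> 0 \<Longrightarrow> integrable lborel (\<lambda>x. std_normal_density (\<epsilon> * x))"
  using lborel_integrable_real_affine[OF integrable_std_normal, of \<epsilon> 0] by simp

lemma std_normal_fourier:
  "(\<integral>y. std_normal_density y *\<^sub>R iexp (t * y) \<partial>lborel) = complex_of_real (exp (- (t\<^sup>2) / 2))"
proof -
  have "(\<integral>y. std_normal_density y *\<^sub>R iexp (t * y) \<partial>lborel) = char std_normal_distribution t"
    unfolding char_def by (subst integral_density) (auto simp: normal_density_nonneg)
  then show ?thesis by (simp add: char_std_normal_distribution)
qed

lemma std_normal_fourier_scaled:
  assumes "\<epsilon> > 0"
  shows "(\<integral>w. std_normal_density (\<epsilon> * w) *\<^sub>R iexp (t * w) \<partial>lborel)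
    = complex_of_real (sqrt (2 * pi) / \<epsilon> * std_normal_density (t / \<epsilon>))"
proof -
  have "complex_of_real (exp (- ((t / \<epsilon>)\<^sup>2) / 2)) =
    \<bar>\<epsilon>\<bar> *\<^sub>R (\<integral>w. std_normal_density (0 + \<epsilon> * w) *\<^sub>R iexp (t / \<epsilon> * (0 + \<epsilon> * w)) \<partial>lborel)"
    using assms unfolding std_normal_fourier[symmetric]
    by (subst lborel_integral_real_affine[of \<epsilon> _ 0]) auto
  also have "\<dots> = \<epsilon> * (\<integral>w. std_normal_density (\<epsilon> * w) *\<^sub>R iexp (t * w) \<partial>lborel)"
    using assms by (simp add: scaleR_conv_of_real)
  finally show ?thesis
    using assms by (simp add: normal_density_def field_simps)
qed

text \<open>The convolution of \<open>f\<close> with the centred Gaussian of standard deviation \<open>\<epsilon>\<close>, written as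
  an average of translates of \<open>f\<close>: in this form continuity of translation gives the convergence
  to \<open>f\<close> directly.\<close>

definition gauss_mean :: "(real \<Rightarrow> complex) \<Rightarrow> real \<Rightarrow> real \<Rightarrow> complex" where
  "gauss_mean f \<epsilon> x = (\<integral>y. std_normal_density y *\<^sub>R f (x + \<epsilon> * y) \<partial>lborel)"

lemma gauss_mean_measurable [measurable]:
  assumes [measurable]: "f \<in> borel_measurable borel"
  shows "gauss_mean f \<epsilon> \<in> borel_measurable borel"
  unfolding gauss_mean_def[abs_def] by measurable

lemma gauss_mean_integrable_prod:
  fixes f :: "real \<Rightarrow> complex"
  assumes f: "integrable lborel f"
  shows "integrable (lborel \<Otimes>\<^sub>M lborel) (\<lambda>(y, x). std_normal_density y *\<^sub>R f (x + \<epsilon> * y))"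
proof (rule lborel_pair.Fubini_integrable)
  have [measurable]: "f \<in> borel_measurable borel" using f by auto
  show "(\<lambda>(y, x). std_normal_density y *\<^sub>R f (x + \<epsilon> * y)) \<in> borel_measurable (lborel \<Otimes>\<^sub>M lborel)"
    by measurable
  have "(\<integral>x. norm (f (x + \<epsilon> * y)) \<partial>lborel) = (\<integral>x. norm (f x) \<partial>lborel)" for y
    by (rule integral_translate)
  then show "integrable lborel (\<lambda>y. \<integral>x. norm (case (y, x) of (y, x) \<Rightarrow> std_normal_density y *\<^sub>R f (x + \<epsilon> * y)) \<partial>lborel)"
    using integrable_std_normal by (simp add: normal_density_nonneg)
  show "AE y in lborel. integrable lborel (\<lambda>x. case (y, x) of (y, x) \<Rightarrow> std_normal_density y *\<^sub>R f (x + \<epsilon> * y))"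
    using integrable_translate[OF f] by simp
qed

lemma gauss_mean_integrable:
  assumes f: "integrable lborel f"
  shows "integrable lborel (gauss_mean f \<epsilon>)"
  using lborel_pair.integrable_fst'[OF lborel_pair.integrable_product_swap[OF gauss_mean_integrable_prod[OF f, of \<epsilon>]]]
  unfolding gauss_mean_def[abs_def] by simp

lemma fourier_gauss_mean:
  assumes f: "integrable lborel f"
  shows "fourier_integral (gauss_mean f \<epsilon>) \<omega> = complex_of_real (exp (- (\<epsilon> * \<omega>)\<^sup>2 / 2)) * fourier_integral f \<omega>"
proof -
  have [measurable]: "f \<in> borel_measurable borel" using f by auto
  let ?e = "\<lambda>x. exp (- (\<i> * complex_of_real \<omega> * complex_of_real x))"
  have int: "integrable (lborel \<Otimes>\<^sub>M lborel) (\<lambda>(y, x). (std_normal_density y *\<^sub>R f (x + \<epsilon> * y)) * ?e x)"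
    by (rule Bochner_Integration.integrable_bound[OF gauss_mean_integrable_prod[OF f, of \<epsilon>]])
       (auto simp: norm_mult)
  have "fourier_integral (gauss_mean f \<epsilon>) \<omega>
    = (\<integral>x. (\<integral>y. (std_normal_density y *\<^sub>R f (x + \<epsilon> * y)) * ?e x \<partial>lborel) \<partial>lborel)"
    unfolding fourier_integral_def gauss_mean_def by (simp flip: integral_mult_left_zero)
  also have "\<dots> = (\<integral>y. (\<integral>x. (std_normal_density y *\<^sub>R f (x + \<epsilon> * y)) * ?e x \<partial>lborel) \<partial>lborel)"
    by (rule lborel_pair.Fubini_integral[OF int])
  also have "\<dots> = (\<integral>y. (std_normal_density y *\<^sub>R iexp (\<epsilon> * \<omega> * y)) * fourier_integral f \<omega> \<partial>lborel)"
  proof (rule Bochner_Integration.integral_cong[OF refl])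
    fix y
    have "(\<integral>x. (std_normal_density y *\<^sub>R f (x + \<epsilon> * y)) * ?e x \<partial>lborel)
       = (\<integral>x. (std_normal_density y *\<^sub>R iexp (\<epsilon> * \<omega> * y)) * (f (x + \<epsilon> * y) * ?e (x + \<epsilon> * y)) \<partial>lborel)"
      by (intro Bochner_Integration.integral_cong[OF refl])
         (auto simp: scaleR_conv_of_real exp_minus field_simps exp_add[symmetric] simp flip: exp_add)
    also have "\<dots> = (std_normal_density y *\<^sub>R iexp (\<epsilon> * \<omega> * y)) * fourier_integral f \<omega>"
      unfolding fourier_integral_def using integral_translate[of "\<lambda>x. f x * ?e x" "\<epsilon> * y"] by simp
    finally show "(\<integral>x. (std_normal_density y *\<^sub>R f (x + \<epsilon> * y)) * ?e x \<partial>lborel)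
       = (std_normal_density y *\<^sub>R iexp (\<epsilon> * \<omega> * y)) * fourier_integral f \<omega>" .
  qed
  also have "\<dots> = exp (- (\<epsilon> * \<omega>)\<^sup>2 / 2) * fourier_integral f \<omega>"
    unfolding integral_mult_left_zero std_normal_fourier by simp
  finally show ?thesis .
qed

lemma integrable_gauss_fourier:
  assumes f: "integrable lborel f" and e: "\<epsilon> > 0"
  shows "integrable lborel (\<lambda>w. std_normal_density (\<epsilon> * w) *\<^sub>R fourier_integral f w)"
proof (rule Bochner_Integration.integrable_bound)
  have [measurable]: "f \<in> borel_measurable borel" using f by auto
  show "(\<lambda>w. std_normal_density (\<epsilon> * w) *\<^sub>R fourier_integral f w) \<in> borel_measurable lborel"
    by simp
  show "integrable lborel (\<lambda>w. std_normal_density (\<epsilon> * w) * (\<integral>x. norm (f x) \<partial>lborel))"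
    using integrable_std_normal_scaled[of \<epsilon>] e by simp
  show "AE w in lborel. norm (std_normal_density (\<epsilon> * w) *\<^sub>R fourier_integral f w)
      \<le> norm (std_normal_density (\<epsilon> * w) * (\<integral>x. norm (f x) \<partial>lborel))"
    by (auto simp: normal_density_nonneg abs_mult intro!: mult_left_mono norm_fourier_integral_le)
qed

text \<open>Fourier inversion is elementary for a Gaussian mean: the factor damping the transform of
  \<open>f\<close> is itself a Gaussian, hence integrable, so that the two integrals can be exchanged and the
  inner one is again the transform of a Gaussian.\<close>

lemma gauss_mean_inversion:
  assumes f: "integrable lborel f" and e: "\<epsilon> > 0"
  shows "gauss_mean f \<epsilon> x
    = 1 / sqrt (2 * pi) * (\<integral>w. (std_normal_density (\<epsilon> * w) *\<^sub>R fourier_integral f w) * iexp (x * w) \<partial>lborel)"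
proof -
  have [measurable]: "f \<in> borel_measurable borel" using f by auto
  let ?F = "\<lambda>u w. f u * (std_normal_density (\<epsilon> * w) *\<^sub>R iexp ((x - u) * w))"
  have int: "integrable (lborel \<Otimes>\<^sub>M lborel) (case_prod ?F)"
  proof (rule integrable_product_bound[OF _ f])
    show "integrable lborel (\<lambda>w. complex_of_real (std_normal_density (\<epsilon> * w)))"
      using integrable_std_normal_scaled[of \<epsilon>] e by simp
  qed (auto simp: norm_mult)
  have "(\<integral>w. (std_normal_density (\<epsilon> * w) *\<^sub>R fourier_integral f w) * iexp (x * w) \<partial>lborel)
     = (\<integral>w. (\<integral>u. ?F u w \<partial>lborel) \<partial>lborel)"
  proof (rule Bochner_Integration.integral_cong[OF refl])
    fix w
    have "(\<integral>u. ?F u w \<partial>lborel) = (\<integral>u. (std_normal_density (\<epsilon> * w) *\<^sub>R iexp (x * w)) *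
       (f u * exp (- (\<i> * complex_of_real w * complex_of_real u))) \<partial>lborel)"
      by (intro Bochner_Integration.integral_cong[OF refl])
         (auto simp: scaleR_conv_of_real exp_minus field_simps simp flip: exp_add)
    also have "\<dots> = (std_normal_density (\<epsilon> * w) *\<^sub>R iexp (x * w)) * fourier_integral f w"
      unfolding fourier_integral_def by (rule integral_mult_right_zero)
    finally show "(std_normal_density (\<epsilon> * w) *\<^sub>R fourier_integral f w) * iexp (x * w) = (\<integral>u. ?F u w \<partial>lborel)"
      by (metis (no_types) mult.commute mult_scaleR_left)
  qed
  also have "\<dots> = (\<integral>u. (\<integral>w. ?F u w \<partial>lborel) \<partial>lborel)"
    by (rule lborel_pair.Fubini_integral[OF int])
  also have "\<dots> = (\<integral>u. f u * complex_of_real (sqrt (2 * pi) / \<epsilon> * std_normal_density ((x - u) / \<epsilon>)) \<partial>lborel)"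
    by (simp only: integral_mult_right_zero std_normal_fourier_scaled[OF e])
  also have "\<dots> = \<epsilon> *\<^sub>R (\<integral>y. f (x + \<epsilon> * y) * complex_of_real (sqrt (2 * pi) / \<epsilon> * std_normal_density ((x - (x + \<epsilon> * y)) / \<epsilon>)) \<partial>lborel)"
    using e by (subst lborel_integral_real_affine[of \<epsilon> _ x]) auto
  also have "\<dots> = \<epsilon> *\<^sub>R (\<integral>y. (sqrt (2 * pi) / \<epsilon>) * (std_normal_density y *\<^sub>R f (x + \<epsilon> * y)) \<partial>lborel)"
    using e by (intro arg_cong[where f="\<lambda>x. \<epsilon> *\<^sub>R x"] Bochner_Integration.integral_cong refl)
      (simp add: scaleR_conv_of_real normal_density_def field_simps)
  also have "\<dots> = sqrt (2 * pi) * gauss_mean f \<epsilon> x"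
    using e by (simp add: gauss_mean_def scaleR_conv_of_real)
  finally show ?thesis by simp
qed

lemma gauss_mean_bounded:
  assumes f: "integrable lborel f" and e: "\<epsilon> > 0"
  obtains B where "\<And>x. norm (gauss_mean f \<epsilon> x) \<le> B"
proof
  fix x
  have "norm (\<integral>w. (std_normal_density (\<epsilon> * w) *\<^sub>R fourier_integral f w) * iexp (x * w) \<partial>lborel)
    \<le> (\<integral>w. norm ((std_normal_density (\<epsilon> * w) *\<^sub>R fourier_integral f w) * iexp (x * w)) \<partial>lborel)"
    by (rule integral_norm_bound)
  then show "norm (gauss_mean f \<epsilon> x) \<le>
      1 / sqrt (2 * pi) * (\<integral>w. norm (std_normal_density (\<epsilon> * w) *\<^sub>R fourier_integral f w) \<partial>lborel)"
    unfolding gauss_mean_inversion[OF f e] by (simp add: norm_mult norm_divide divide_right_mono)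
qed

text \<open>Inserting the inversion formula for one of the two factors of \<open>\<bar>h\<bar>\<^sup>2\<close>, where \<open>h\<close> is the
  Gaussian mean, and exchanging the integrals turns the other factor into its own transform.
  The result is an equation with the damping factor \<open>exp (- (\<epsilon> \<omega>)\<^sup>2) \<le> 1\<close> under the integral on the
  right; dropping it leaves a bound that is uniform in \<open>\<epsilon>\<close>.\<close>

lemma gauss_mean_plancherel:
  assumes f: "integrable lborel f" and e: "\<epsilon> > 0"
  shows "(\<integral>\<^sup>+ x. ennreal ((norm (gauss_mean f \<epsilon> x))\<^sup>2) \<partial>lborel)
    \<le> ennreal (1 / (2 * pi)) * (\<integral>\<^sup>+ w. ennreal ((norm (fourier_integral f w))\<^sup>2) \<partial>lborel)"
proof -
  have [measurable]: "f \<in> borel_measurable borel" using f by auto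
  define h where "h = gauss_mean f \<epsilon>"
  have [measurable]: "h \<in> borel_measurable borel" unfolding h_def by simp
  have hi: "integrable lborel h" unfolding h_def by (rule gauss_mean_integrable[OF f])
  define G where "G = (\<lambda>w. std_normal_density (\<epsilon> * w) *\<^sub>R fourier_integral f w)"
  have Gi: "integrable lborel G" unfolding G_def by (rule integrable_gauss_fourier[OF f e])
  have [measurable]: "G \<in> borel_measurable borel" using Gi by auto
  obtain B where B: "\<And>x. norm (h x) \<le> B" using gauss_mean_bounded[OF f e] unfolding h_def by blast
  have h2: "integrable lborel (\<lambda>x. (norm (h x))\<^sup>2)"
  proof (rule Bochner_Integration.integrable_bound)
    show "integrable lborel (\<lambda>x. B * norm (h x))" using hi by simp
    show "AE x in lborel. norm ((norm (h x))\<^sup>2) \<le> norm (B * norm (h x))"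
      using B by (auto simp: power2_eq_square abs_mult intro!: mult_right_mono abs_ge_self order_trans[OF B])
  qed simp
  let ?F = "\<lambda>x w. cnj (h x) * (G w * iexp (x * w))"
  have int: "integrable (lborel \<Otimes>\<^sub>M lborel) (case_prod ?F)"
    by (rule integrable_product_bound[OF _ hi Gi]) (auto simp: norm_mult)
  have "complex_of_real (\<integral>x. (norm (h x))\<^sup>2 \<partial>lborel) = (\<integral>x. cnj (h x) * h x \<partial>lborel)"
    by (subst integral_complex_of_real[symmetric], intro Bochner_Integration.integral_cong refl,
        subst complex_norm_square, rule mult.commute)
  also have "\<dots> = (\<integral>x. 1 / sqrt (2 * pi) * (\<integral>w. ?F x w \<partial>lborel) \<partial>lborel)"
  proof (rule Bochner_Integration.integral_cong[OF refl])
    fix x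
    have hx: "h x = 1 / sqrt (2 * pi) * (\<integral>w. G w * iexp (x * w) \<partial>lborel)"
      unfolding h_def G_def by (rule gauss_mean_inversion[OF f e])
    show "cnj (h x) * h x = 1 / sqrt (2 * pi) * (\<integral>w. ?F x w \<partial>lborel)"
      by (subst (2) hx, subst integral_mult_right_zero, rule mult.left_commute)
  qed
  also have "\<dots> = 1 / sqrt (2 * pi) * (\<integral>x. (\<integral>w. ?F x w \<partial>lborel) \<partial>lborel)"
    by simp
  also have "(\<integral>x. (\<integral>w. ?F x w \<partial>lborel) \<partial>lborel) = (\<integral>w. (\<integral>x. ?F x w \<partial>lborel) \<partial>lborel)"
    by (rule lborel_pair.Fubini_integral[OF int, symmetric])
  also have "\<dots> = (\<integral>w. G w * cnj (fourier_integral h w) \<partial>lborel)"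
  proof (rule Bochner_Integration.integral_cong[OF refl])
    fix w
    have "cnj (fourier_integral h w) = (\<integral>x. cnj (h x * exp (- (\<i> * complex_of_real w * complex_of_real x))) \<partial>lborel)"
      unfolding fourier_integral_def by (rule Bochner_Integration.integral_cnj[symmetric])
    also have "\<dots> = (\<integral>x. cnj (h x) * iexp (x * w) \<partial>lborel)"
      by (simp add: exp_cnj mult_ac)
    finally show "(\<integral>x. ?F x w \<partial>lborel) = G w * cnj (fourier_integral h w)"
      by (simp flip: integral_mult_right_zero add: mult_ac)
  qed
  also have "\<dots> = (\<integral>w. complex_of_real (1 / sqrt (2 * pi) * exp (- (\<epsilon> * w)\<^sup>2) * (norm (fourier_integral f w))\<^sup>2) \<partial>lborel)"
  proof (rule Bochner_Integration.integral_cong[OF refl])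
    fix w
    have "exp (- (\<epsilon> * w)\<^sup>2) = exp (- (\<epsilon> * w)\<^sup>2 / 2) * exp (- (\<epsilon> * w)\<^sup>2 / 2)"
      by (simp flip: exp_add)
    then show "G w * cnj (fourier_integral h w) = complex_of_real (1 / sqrt (2 * pi) * exp (- (\<epsilon> * w)\<^sup>2) * (norm (fourier_integral f w))\<^sup>2)"
      unfolding h_def fourier_gauss_mean[OF f] G_def
      using complex_norm_square[of "fourier_integral f w"]
      by (simp add: scaleR_conv_of_real normal_density_def mult_ac)
  qed
  also have "\<dots> = complex_of_real (\<integral>w. (1 / sqrt (2 * pi) * exp (- (\<epsilon> * w)\<^sup>2) * (norm (fourier_integral f w))\<^sup>2) \<partial>lborel)"
    by (rule integral_complex_of_real)
  finally have eq: "(\<integral>x. (norm (h x))\<^sup>2 \<partial>lborel) = 1 / (2 * pi) * (\<integral>w. exp (- (\<epsilon> * w)\<^sup>2) * (norm (fourier_integral f w))\<^sup>2 \<partial>lborel)"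
    by (simp add: mult.assoc flip: of_real_mult of_real_divide)
  have "(\<integral>\<^sup>+ x. ennreal ((norm (h x))\<^sup>2) \<partial>lborel) = ennreal (\<integral>x. (norm (h x))\<^sup>2 \<partial>lborel)"
    by (rule nn_integral_eq_integral[OF h2]) simp
  also have "\<dots> = ennreal (1 / (2 * pi)) * ennreal (\<integral>w. exp (- (\<epsilon> * w)\<^sup>2) * (norm (fourier_integral f w))\<^sup>2 \<partial>lborel)"
    unfolding eq by (rule ennreal_mult) auto
  also have "ennreal (\<integral>w. exp (- (\<epsilon> * w)\<^sup>2) * (norm (fourier_integral f w))\<^sup>2 \<partial>lborel)
     \<le> (\<integral>\<^sup>+w. ennreal (exp (- (\<epsilon> * w)\<^sup>2) * (norm (fourier_integral f w))\<^sup>2) \<partial>lborel)"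
    by (cases "integrable lborel (\<lambda>w. exp (- (\<epsilon> * w)\<^sup>2) * (norm (fourier_integral f w))\<^sup>2)")
       (auto simp: nn_integral_eq_integral not_integrable_integral_eq)
  also have "\<dots> \<le> (\<integral>\<^sup>+ w. ennreal ((norm (fourier_integral f w))\<^sup>2) \<partial>lborel)"
    by (intro nn_integral_mono ennreal_leI mult_left_le_one_le) auto
  finally show ?thesis unfolding h_def by (simp add: mult_left_mono)
qed

text \<open>The distance is at most the Gaussian average of the \<open>L\<^sup>1\<close> distances between \<open>f\<close> and its
  translates by \<open>e n * y\<close>; each of these tends to \<open>0\<close>, and all are bounded by twice the norm
  of \<open>f\<close>.\<close>

lemma gauss_mean_L1_tendsto:
  assumes f: "integrable lborel f" and e: "e \<longlonglongrightarrow> 0"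
  shows "(\<lambda>n. \<integral>x. norm (gauss_mean f (e n) x - f x) \<partial>lborel) \<longlonglongrightarrow> 0"
proof (rule tendsto_sandwich[OF _ _ tendsto_const])
  have [measurable]: "f \<in> borel_measurable borel" using f by auto
  let ?F = "\<lambda>n y x. std_normal_density y *\<^sub>R (f (x + e n * y) - f x)"
  let ?D = "\<lambda>n y. \<integral>x. norm (f (x + e n * y) - f x) \<partial>lborel"
  have D: "?D n y \<le> 2 * (\<integral>x. norm (f x) \<partial>lborel)" for n y
  proof -
    have "?D n y \<le> (\<integral>x. norm (f (x + e n * y)) + norm (f x) \<partial>lborel)"
      using f by (intro integral_mono norm_triangle_ineq4 Bochner_Integration.integrable_add 
          Bochner_Integration.integrable_diff integrable_norm integrable_translate)
    also have "\<dots> = 2 * (\<integral>x. norm (f x) \<partial>lborel)"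
      using f integrable_translate[OF integrable_norm[OF f]] 
        integral_translate[of "\<lambda>x. norm (f x)" "e n * y"] by simp
    finally show ?thesis .
  qed
  have D0: "0 \<le> ?D n y" for n y by simp
  have int: "integrable lborel (\<lambda>y. std_normal_density y * ?D n y)" for n
  proof (rule Bochner_Integration.integrable_bound)
    show "integrable lborel (\<lambda>y. std_normal_density y * (2 * (\<integral>x. norm (f x) \<partial>lborel)))"
      using integrable_std_normal by simp
    show "AE y in lborel. norm (std_normal_density y * ?D n y) \<le> norm (std_normal_density y * (2 * (\<integral>x. norm (f x) \<partial>lborel)))"
      using D D0 by (auto simp: normal_density_nonneg abs_mult intro!: mult_left_mono)
  qed simp
  have intF: "integrable (lborel \<Otimes>\<^sub>M lborel) (\<lambda>(y, x). ?F n y x)" for n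
    using int[of n] f by (intro lborel_pair.Fubini_integrable)
      (auto simp: normal_density_nonneg
        intro!: integrable_scaleR_right Bochner_Integration.integrable_diff integrable_translate)
  show "\<forall>\<^sub>F n in sequentially. (\<integral>x. norm (gauss_mean f (e n) x - f x) \<partial>lborel)
      \<le> (\<integral>y. std_normal_density y * ?D n y \<partial>lborel)"
  proof (rule always_eventually, rule allI)
    fix n
    note sw = lborel_pair.integrable_product_swap[OF intF[of n]]
    have sec: "AE x in lborel. integrable lborel (\<lambda>y. std_normal_density y *\<^sub>R f (x + e n * y))"
      using lborel_pair.AE_integrable_fst'[OF lborel_pair.integrable_product_swap[OF gauss_mean_integrable_prod[OF f, of "e n"]]]
      by simp
    have "(\<integral>x. norm (gauss_mean f (e n) x - f x) \<partial>lborel) = (\<integral>x. norm (\<integral>y. ?F n y x \<partial>lborel) \<partial>lborel)"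
    proof (rule integral_cong_AE)
      show "AE x in lborel. norm (gauss_mean f (e n) x - f x) = norm (\<integral>y. ?F n y x \<partial>lborel)"
        using sec
      proof eventually_elim
        case (elim x)
        have "(\<integral>y. ?F n y x \<partial>lborel) = (\<integral>y. std_normal_density y *\<^sub>R f (x + e n * y) \<partial>lborel)
           - (\<integral>y. std_normal_density y *\<^sub>R f x \<partial>lborel)"
          using elim integrable_std_normal by (simp add: scaleR_diff_right)
        then show ?case using integrable_std_normal by (simp add: gauss_mean_def)
      qed
    qed simp_all
    also have "\<dots> \<le> (\<integral>x. (\<integral>y. norm (?F n y x) \<partial>lborel) \<partial>lborel)"
      using lborel_pair.integrable_fst'[OF sw] lborel_pair.integrable_fst'[OF integrable_norm[OF sw]]
      by (intro integral_mono) (auto intro!: integral_norm_bound simp: split_def simp del: norm_scaleR)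
    also have "\<dots> = (\<integral>y. (\<integral>x. norm (?F n y x) \<partial>lborel) \<partial>lborel)"
      using integrable_norm[OF intF[of n]]
      by (intro lborel_pair.Fubini_integral) (simp add: split_def)
    also have "\<dots> = (\<integral>y. std_normal_density y * ?D n y \<partial>lborel)"
      by (simp add: normal_density_nonneg)
    finally show "(\<integral>x. norm (gauss_mean f (e n) x - f x) \<partial>lborel) \<le> (\<integral>y. std_normal_density y * ?D n y \<partial>lborel)" .
  qed
  have "(\<lambda>n. \<integral>y. std_normal_density y * ?D n y \<partial>lborel) \<longlonglongrightarrow> (\<integral>y. 0 \<partial>(lborel :: real measure))"
  proof (rule integral_dominated_convergence)
    show "integrable lborel (\<lambda>y. std_normal_density y * (2 * (\<integral>x. norm (f x) \<partial>lborel)))"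
      using integrable_std_normal by simp
    show "AE y in lborel. norm (std_normal_density y * ?D n y) \<le> std_normal_density y * (2 * (\<integral>x. norm (f x) \<partial>lborel))" for n
      using D D0 by (auto simp: normal_density_nonneg abs_mult intro!: mult_left_mono)
    have "(\<lambda>n. ?D n y) \<longlonglongrightarrow> 0" for y
      by (rule L1_translation_continuous[OF f tendsto_mult_left_zero[OF e]])
    then show "AE y in lborel. (\<lambda>n. std_normal_density y * ?D n y) \<longlonglongrightarrow> 0"
      by (auto intro!: tendsto_mult_right_zero)
  qed simp_all
  then show "(\<lambda>n. \<integral>y. std_normal_density y * ?D n y \<partial>lborel) \<longlonglongrightarrow> 0" by simp
qed simp

text \<open>A subsequence of the Gaussian means converges to \<open>f\<close> almost everywhere, and Fatou's lemma
  transports their uniform bound to \<open>f\<close>. Both sides may be infinite: \<open>f\<close> is only assumed to be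
  integrable, which lets the inequality establish square-integrability.\<close>

theorem plancherel_inequality:
  assumes f: "integrable lborel f"
  shows "(\<integral>\<^sup>+ x. ennreal ((norm (f x))\<^sup>2) \<partial>lborel)
    \<le> ennreal (1 / (2 * pi)) * (\<integral>\<^sup>+ w. ennreal ((norm (fourier_integral f w))\<^sup>2) \<partial>lborel)"
    (is "_ \<le> ?B")
proof -
  have [measurable]: "f \<in> borel_measurable borel" using f by auto
  define e where "e = (\<lambda>n. 1 / real (Suc n))"
  have e: "e \<longlonglongrightarrow> 0" "\<And>n. e n > 0"
    unfolding e_def using LIMSEQ_inverse_real_of_nat by (auto simp: inverse_eq_divide)
  have "\<exists>r::nat\<Rightarrow>nat. strict_mono r \<and> (AE x in lborel. (\<lambda>n. gauss_mean f (e (r n)) x - f x) \<longlonglongrightarrow> 0)"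
    using f gauss_mean_integrable[OF f] by (intro tendsto_L1_AE_subseq gauss_mean_L1_tendsto e) auto
  then obtain r :: "nat \<Rightarrow> nat" where
    r: "AE x in lborel. (\<lambda>n. gauss_mean f (e (r n)) x) \<longlonglongrightarrow> f x"
    by (auto simp: LIM_zero_iff)
  have "(\<integral>\<^sup>+ x. ennreal ((norm (f x))\<^sup>2) \<partial>lborel)
     = (\<integral>\<^sup>+ x. liminf (\<lambda>n. ennreal ((norm (gauss_mean f (e (r n)) x))\<^sup>2)) \<partial>lborel)"
  proof (rule nn_integral_cong_AE)
    show "AE x in lborel. ennreal ((norm (f x))\<^sup>2) = liminf (\<lambda>n. ennreal ((norm (gauss_mean f (e (r n)) x))\<^sup>2))"
      using r
    proof eventually_elim
      case (elim x)
      have "(\<lambda>n. ennreal ((norm (gauss_mean f (e (r n)) x))\<^sup>2)) \<longlonglongrightarrow> ennreal ((norm (f x))\<^sup>2)"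
        by (intro tendsto_intros tendsto_ennrealI elim)
      then show ?case by (rule lim_imp_Liminf[symmetric, rotated]) simp
    qed
  qed
  also have "\<dots> \<le> liminf (\<lambda>n. \<integral>\<^sup>+ x. ennreal ((norm (gauss_mean f (e (r n)) x))\<^sup>2) \<partial>lborel)"
    by (rule nn_integral_liminf) simp
  also have "\<dots> \<le> ?B"
    using gauss_mean_plancherel[OF f e(2)]
    by (intro Liminf_le[THEN order_trans] always_eventually) auto
  finally show ?thesis .
qed


section \<open>The Fourier transform of square-integrable functions\<close>

lemma nn_integral_L2_triangle:
  fixes f g h :: "real \<Rightarrow> complex"
  assumes [measurable]: "f \<in> borel_measurable borel" "g \<in> borel_measurable borel" "h \<in> borel_measurable borel"
  shows "(\<integral>\<^sup>+ x. ennreal ((cmod (f x - h x))\<^sup>2) \<partial>lborel)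
    \<le> 2 * (\<integral>\<^sup>+ x. ennreal ((cmod (f x - g x))\<^sup>2) \<partial>lborel) + 2 * (\<integral>\<^sup>+ x. ennreal ((cmod (g x - h x))\<^sup>2) \<partial>lborel)"
proof -
  have "(cmod (f x - h x))\<^sup>2 \<le> 2 * (cmod (f x - g x))\<^sup>2 + 2 * (cmod (g x - h x))\<^sup>2" for x
  proof -
    have "cmod (f x - h x) \<le> cmod (f x - g x) + cmod (g x - h x)"
      using norm_triangle_ineq[of "f x - g x" "g x - h x"] by simp
    then have "(cmod (f x - h x))\<^sup>2 \<le> (cmod (f x - g x) + cmod (g x - h x))\<^sup>2"
      by (intro power_mono) auto
    also have "\<dots> \<le> 2 * (cmod (f x - g x))\<^sup>2 + 2 * (cmod (g x - h x))\<^sup>2"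
      using sum_squares_ge_zero[of "cmod (f x - g x) - cmod (g x - h x)" 0]
      by (simp add: power2_eq_square algebra_simps)
    finally show ?thesis .
  qed
  then have "(\<integral>\<^sup>+ x. ennreal ((cmod (f x - h x))\<^sup>2) \<partial>lborel)
    \<le> (\<integral>\<^sup>+ x. 2 * ennreal ((cmod (f x - g x))\<^sup>2) + 2 * ennreal ((cmod (g x - h x))\<^sup>2) \<partial>lborel)"
    by (intro nn_integral_mono) (simp add: ennreal_leI flip: ennreal_plus ennreal_mult' ennreal_numeral)
  also have "\<dots> = 2 * (\<integral>\<^sup>+ x. ennreal ((cmod (f x - g x))\<^sup>2) \<partial>lborel) + 2 * (\<integral>\<^sup>+ x. ennreal ((cmod (g x - h x))\<^sup>2) \<partial>lborel)"
    by (simp add: nn_integral_add nn_integral_cmult)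
  finally show ?thesis .
qed

lemma fourier_integral_diff:
  assumes u: "integrable lborel u" and v: "integrable lborel v"
  shows "fourier_integral (\<lambda>x. u x - v x) \<omega> = fourier_integral u \<omega> - fourier_integral v \<omega>"
proof -
  have int: "integrable lborel (\<lambda>x. f x * exp (- (\<i> * complex_of_real \<omega> * complex_of_real x)))"
    if "integrable lborel f" for f
    using that by (intro Bochner_Integration.integrable_bound[OF that]) (auto simp: norm_mult)
  show ?thesis
    unfolding fourier_integral_def using int[OF u] int[OF v] by (simp add: left_diff_distrib)
qed

text \<open>If \<open>u\<close> and \<open>v\<close> approximate \<open>f\<close> and \<open>g\<close> and their transforms have the same limit \<open>F\<close>, then
  the transform of \<open>u n - v n\<close> tends to \<open>0\<close> in \<open>L\<^sup>2\<close>, and by the Plancherel inequality so does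
  \<open>u n - v n\<close> itself.\<close>

lemma has_L2_fourier_unique:
  assumes "has_L2_fourier f F" "has_L2_fourier g F"
  shows "AE x in lborel. f x = g x"
proof -
  obtain u where u: "\<And>n. integrable lborel (u n)" "L2_converges u f" "L2_converges (\<lambda>n. fourier_integral (u n)) F"
    using assms(1) unfolding has_L2_fourier_def by blast
  obtain v where v: "\<And>n. integrable lborel (v n)" "L2_converges v g" "L2_converges (\<lambda>n. fourier_integral (v n)) F"
    using assms(2) unfolding has_L2_fourier_def by blast
  have [measurable]: "f \<in> borel_measurable borel" "g \<in> borel_measurable borel" "F \<in> borel_measurable borel"
    using assms by (auto simp: has_L2_fourier_def square_integrable_def)
  have [measurable]: "u n \<in> borel_measurable borel" "v n \<in> borel_measurable borel" for n
    using borel_measurable_integrable[OF u(1)] borel_measurable_integrable[OF v(1)] by auto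
  define D where "D p q = (\<integral>\<^sup>+ x. ennreal ((cmod (p x - q x))\<^sup>2) \<partial>lborel)" for p q :: "real \<Rightarrow> complex"
  have sym: "D p q = D q p" for p q unfolding D_def by (simp add: norm_minus_commute)
  have tri: "D p r \<le> 2 * D p q + 2 * D q r"
    if "p \<in> borel_measurable borel" "q \<in> borel_measurable borel" "r \<in> borel_measurable borel" for p q r
    unfolding D_def by (rule nn_integral_L2_triangle[OF that])
  define c where "c = ennreal (1 / (2 * pi))"
  have le: "D f g \<le> 2 * D (u n) f + 2 * (2 * (c * (2 * D (fourier_integral (u n)) F + 2 * D (fourier_integral (v n)) F))
      + 2 * D (v n) g)" for n
  proof -
    have "D (u n) (v n) \<le> c * D (fourier_integral (u n)) (fourier_integral (v n))"
      unfolding D_def c_def using plancherel_inequality[of "\<lambda>x. u n x - v n x"] u(1) v(1)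
      by (simp add: fourier_integral_diff)
    also have "\<dots> \<le> c * (2 * D (fourier_integral (u n)) F + 2 * D F (fourier_integral (v n)))"
      by (intro mult_left_mono tri) simp_all
    finally have uv: "D (u n) (v n) \<le> c * (2 * D (fourier_integral (u n)) F + 2 * D (fourier_integral (v n)) F)"
      by (simp add: sym[of F])
    have "D f g \<le> 2 * D f (u n) + 2 * D (u n) g" by (intro tri) simp_all
    also have "D (u n) g \<le> 2 * D (u n) (v n) + 2 * D (v n) g" by (intro tri) simp_all
    also note uv
    finally show ?thesis by (simp add: sym[of f] mult_left_mono add_mono)
  qed
  have lims: "(\<lambda>n. D (u n) f) \<longlonglongrightarrow> 0" "(\<lambda>n. D (v n) g) \<longlonglongrightarrow> 0"
     "(\<lambda>n. D (fourier_integral (u n)) F) \<longlonglongrightarrow> 0" "(\<lambda>n. D (fourier_integral (v n)) F) \<longlonglongrightarrow> 0"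
    using u(2,3) v(2,3) by (simp_all add: L2_converges_def D_def)
  have "(\<lambda>n. 2 * D (u n) f + 2 * (2 * (c * (2 * D (fourier_integral (u n)) F + 2 * D (fourier_integral (v n)) F))
      + 2 * D (v n) g)) \<longlonglongrightarrow> 2 * 0 + 2 * (2 * (c * (2 * 0 + 2 * 0)) + 2 * 0)"
    by (intro tendsto_add ennreal_tendsto_cmult lims) (simp_all add: c_def)
  then have "D f g \<le> 2 * 0 + 2 * (2 * (c * (2 * 0 + 2 * 0)) + 2 * 0)"
    by (rule LIMSEQ_le_const) (use le in blast)
  then have "D f g = 0" by simp
  then have "AE x in lborel. ennreal ((cmod (f x - g x))\<^sup>2) = 0"
    unfolding D_def by (subst (asm) nn_integral_0_iff_AE) auto
  then show ?thesis by eventually_elim simp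
qed

lemma square_integrable_iff:
  "square_integrable f \<longleftrightarrow> f \<in> borel_measurable borel \<and> (\<integral>\<^sup>+ x. ennreal ((cmod (f x))\<^sup>2) \<partial>lborel) < \<infinity>"
  by (auto simp: square_integrable_def integrable_iff_bounded)

lemma L2_converges_dominated:
  assumes [measurable]: "\<And>n. u n \<in> borel_measurable borel" "f \<in> borel_measurable borel"
    and lim: "AE x in lborel. (\<lambda>n. u n x) \<longlonglongrightarrow> f x"
    and le: "\<And>n. AE x in lborel. cmod (u n x) \<le> H x"
    and H: "integrable lborel (\<lambda>x. (H x)\<^sup>2)"
  shows "L2_converges u f" "square_integrable f"
proof -
  have le': "AE x in lborel. \<forall>n. cmod (u n x) \<le> H x"
    unfolding AE_all_countable using le by simp
  have leF: "AE x in lborel. cmod (f x) \<le> H x"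
    using lim le'
  proof eventually_elim
    case (elim x)
    show ?case by (rule LIMSEQ_le_const2[OF tendsto_norm[OF elim(1)]]) (use elim(2) in blast)
  qed
  have Hfin: "(\<integral>\<^sup>+ x. ennreal ((H x)\<^sup>2) \<partial>lborel) < \<infinity>"
    using H by (auto simp: integrable_iff_bounded)
  have [measurable]: "(\<lambda>x. (H x)\<^sup>2) \<in> borel_measurable borel"
    using H by auto
  have "(\<integral>\<^sup>+ x. ennreal ((cmod (f x))\<^sup>2) \<partial>lborel) \<le> (\<integral>\<^sup>+ x. ennreal ((H x)\<^sup>2) \<partial>lborel)"
    using leF by (intro nn_integral_mono_AE) (auto elim!: eventually_mono intro!: ennreal_leI power_mono)
  then show "square_integrable f"
    unfolding square_integrable_iff using Hfin by (auto intro: le_less_trans)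
  have "(\<lambda>n. \<integral>\<^sup>+ x. ennreal ((cmod (u n x - f x))\<^sup>2) \<partial>lborel) \<longlonglongrightarrow> (\<integral>\<^sup>+ x. 0 \<partial>(lborel :: real measure))"
  proof (rule nn_integral_dominated_convergence)
    show "(\<integral>\<^sup>+ x. ennreal (4 * (H x)\<^sup>2) \<partial>lborel) < \<infinity>"
      using Hfin by (simp add: ennreal_mult' nn_integral_cmult ennreal_mult_less_top)
    show "AE x in lborel. ennreal ((cmod (u n x - f x))\<^sup>2) \<le> ennreal (4 * (H x)\<^sup>2)" for n
      using le' leF
    proof eventually_elim
      case (elim x)
      have "cmod (u n x - f x) \<le> 2 * H x"
        using norm_triangle_ineq4[of "u n x" "f x"] elim(1)[rule_format, of n] elim(2) by linarith
      then have "(cmod (u n x - f x))\<^sup>2 \<le> (2 * H x)\<^sup>2" by (intro power_mono) auto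
      then show ?case by (intro ennreal_leI) (simp add: power_mult_distrib)
    qed
    show "AE x in lborel. (\<lambda>n. ennreal ((cmod (u n x - f x))\<^sup>2)) \<longlonglongrightarrow> 0"
      using lim
    proof eventually_elim
      case (elim x)
      have "(\<lambda>n. (cmod (u n x - f x))\<^sup>2) \<longlonglongrightarrow> (cmod (f x - f x))\<^sup>2"
        by (intro tendsto_intros elim)
      then show ?case by (simp flip: ennreal_0 add: tendsto_ennrealI)
    qed
  qed simp_all
  then show "L2_converges u f" by (simp add: L2_converges_def)
qed

text \<open>A criterion for functions whose square-integrability is not visible in the time domain: the
  bound \<open>H\<close> on the transforms of the damped functions \<open>u n\<close> bounds their \<open>L\<^sup>2\<close> norms, by the
  Plancherel inequality, and Fatou's lemma then bounds the norm of \<open>f\<close>. Once \<open>f\<close> is known to be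
  square-integrable it dominates the \<open>u n\<close>, which therefore converge to it in \<open>L\<^sup>2\<close>.\<close>

lemma has_L2_fourier_dominated:
  assumes f [measurable]: "f \<in> borel_measurable borel" and F [measurable]: "F \<in> borel_measurable borel"
    and u: "\<And>n. integrable lborel (u n)" and lim: "\<And>x. (\<lambda>n. u n x) \<longlonglongrightarrow> f x"
    and le: "\<And>n x. cmod (u n x) \<le> cmod (f x)"
    and limF: "AE w in lborel. (\<lambda>n. fourier_integral (u n) w) \<longlonglongrightarrow> F w"
    and leF: "\<And>n w. cmod (fourier_integral (u n) w) \<le> H w"
    and H: "integrable lborel (\<lambda>w. (H w)\<^sup>2)"
  shows "has_L2_fourier f F"
proof -
  have [measurable]: "u n \<in> borel_measurable borel" for n using borel_measurable_integrable[OF u] by auto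
  define K where "K = ennreal (1 / (2 * pi)) * (\<integral>\<^sup>+ w. ennreal ((H w)\<^sup>2) \<partial>lborel)"
  have K: "K < \<infinity>"
    using H by (auto simp: K_def integrable_iff_bounded ennreal_mult_less_top)
  have uK: "(\<integral>\<^sup>+ x. ennreal ((cmod (u n x))\<^sup>2) \<partial>lborel) \<le> K" for n
    unfolding K_def using leF
    by (intro order_trans[OF plancherel_inequality[OF u]] mult_left_mono nn_integral_mono ennreal_leI power_mono) auto
  have "(\<integral>\<^sup>+ x. ennreal ((cmod (f x))\<^sup>2) \<partial>lborel) = (\<integral>\<^sup>+ x. liminf (\<lambda>n. ennreal ((cmod (u n x))\<^sup>2)) \<partial>lborel)"
    by (intro nn_integral_cong lim_imp_Liminf[symmetric] tendsto_intros tendsto_ennrealI lim) simp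
  also have "\<dots> \<le> liminf (\<lambda>n. \<integral>\<^sup>+ x. ennreal ((cmod (u n x))\<^sup>2) \<partial>lborel)"
    by (rule nn_integral_liminf) simp
  also have "\<dots> \<le> K"
    using uK by (intro Liminf_le[THEN order_trans] always_eventually) auto
  finally have sf: "square_integrable f"
    unfolding square_integrable_iff using K by (auto intro: le_less_trans)
  have su: "square_integrable (u n)" for n
    unfolding square_integrable_iff using le_less_trans[OF uK K] by simp
  have "L2_converges u f"
    using sf lim le by (intro L2_converges_dominated[where H = "\<lambda>x. cmod (f x)"])
      (auto simp: square_integrable_def)
  moreover have "L2_converges (\<lambda>n. fourier_integral (u n)) F" "square_integrable F"
    using limF leF H by (intro L2_converges_dominated[where H = H and u = "\<lambda>n. fourier_integral (u n)"]; simp)+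
  ultimately show ?thesis
    unfolding has_L2_fourier_def using sf su u by blast
qed


section \<open>The Laplace transform of truncated powers\<close>

lemma truncated_power_measurable [measurable]:
  assumes [measurable]: "f \<in> borel_measurable M"
  shows "(\<lambda>x. truncated_power (f x) w) \<in> borel_measurable M"
  unfolding truncated_power_def by measurable

lemma truncated_power_eq_powr: "truncated_power x w = (if x > 0 then of_real x powr w else 0)"
  by (auto simp: truncated_power_def powr_def Ln_of_real)

lemma truncated_power_add_nat: "truncated_power x (w + of_nat n) = truncated_power x w * of_real x ^ n"
  by (auto simp: truncated_power_eq_powr powr_add powr_nat')

lemma truncated_power_mult:
  assumes "c > 0"
  shows "truncated_power (c * x) w = of_real c powr w * truncated_power x w"
  using assms by (auto simp: truncated_power_eq_powr zero_less_mult_iff powr_times_real)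

lemma norm_truncated_power: "of_real (cmod (truncated_power x w)) = truncated_power x (of_real (Re w))"
  by (auto simp: truncated_power_def exp_of_real simp flip: of_real_mult)

lemma truncated_power_laplace_one:
  assumes z: "Re z > 0"
  shows "has_bochner_integral lborel (\<lambda>x. truncated_power x (z - 1) * exp (- of_real x)) (Gamma z)"
proof -
  let ?g = "\<lambda>t. complex_of_real t powr (z - 1) / of_real (exp t)"
  let ?f = "\<lambda>x. truncated_power x (z - 1) * exp (- complex_of_real x)"
  have eq: "?f = (\<lambda>x. indicator {0<..} x *\<^sub>R ?g x)"
    by (auto simp: truncated_power_eq_powr exp_minus field_simps exp_of_real fun_eq_iff indicator_def)
  have "integrable lebesgue ?f"
    using absolutely_integrable_Gamma_integral'[OF z] unfolding eq set_integrable_def .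
  moreover have "integral\<^sup>L lebesgue ?f = Gamma z"
    using set_lebesgue_integral_eq_integral(2)[OF absolutely_integrable_Gamma_integral'[OF z]]
      Gamma_integral_complex'[OF z]
    unfolding eq set_lebesgue_integral_def by (auto simp: integral_unique)
  ultimately show ?thesis
    by (simp add: has_bochner_integral_iff integrable_completion integral_completion)
qed

lemma truncated_power_laplace_real:
  assumes z: "Re z > 0" and c: "c > 0"
  shows "has_bochner_integral lborel (\<lambda>x. truncated_power x (z - 1) * exp (- of_real (c * x)))
           (Gamma z * of_real c powr (- z))"
proof -
  let ?f = "\<lambda>x. truncated_power x (z - 1) * exp (- complex_of_real x)"
  have f: "integrable lborel ?f" "integral\<^sup>L lborel ?f = Gamma z"
    using truncated_power_laplace_one[OF z] by (auto simp: has_bochner_integral_iff)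
  have "integrable lborel (\<lambda>x. of_real c powr (1 - z) * ?f (0 + c * x))"
    using lborel_integrable_real_affine[OF f(1), of c 0] c by simp
  moreover have "(\<lambda>x. of_real c powr (1 - z) * ?f (0 + c * x)) = (\<lambda>x. truncated_power x (z - 1) * exp (- of_real (c * x)))"
    using c by (auto simp: truncated_power_mult fun_eq_iff simp flip: powr_add mult.assoc)
  moreover have "(\<integral>x. of_real c powr (1 - z) * ?f (0 + c * x) \<partial>lborel) = Gamma z * of_real c powr (- z)"
  proof -
    have "Gamma z = c *\<^sub>R (\<integral>x. ?f (0 + c * x) \<partial>lborel)"
      unfolding f(2)[symmetric] using c by (subst lborel_integral_real_affine[of c _ 0]) auto
    moreover have "of_real c powr (1 - z) = of_real c * complex_of_real c powr (- z)"
      using c powr_add[of "of_real c" 1 "-z"] by (simp add: powr_one)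
    ultimately show ?thesis
      by (simp add: scaleR_conv_of_real)
  qed
  ultimately show ?thesis by (simp add: has_bochner_integral_iff)
qed

lemma pochhammer_div_fact:
  "pochhammer z n / fact n * w ^ n = ((- z) gchoose n) * (- w :: complex) ^ n"
proof -
  have "(-1 :: complex) ^ n * (-1) ^ n = 1" by (simp flip: power_mult_distrib)
  then show ?thesis
    unfolding gbinomial_pochhammer power_minus[of w n] by (simp add: field_simps)
qed

lemma Gamma_nonzero_Re_pos: "Re z > 0 \<Longrightarrow> Gamma (z :: complex) \<noteq> 0"
  by (auto simp: Gamma_eq_zero_iff nonpos_Ints_def)

lemma Gamma_add_nat: "Re z > 0 \<Longrightarrow> Gamma (z + of_nat n) = Gamma (z :: complex) * pochhammer z n"
  by (subst pochhammer_Gamma) (auto simp: Gamma_eq_zero_iff nonpos_Ints_def)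

text \<open>For real \<open>s\<close> this is Euler's integral, rescaled. A complex \<open>s\<close> in the right half-plane lies in
  some disc \<open>\<bar>s - c\<bar> < c\<close> with \<open>c\<close> real; expanding \<open>exp ((c - s) * x)\<close> and integrating term by term
  with the real case gives a binomial series that sums to the stated power.\<close>

lemma truncated_power_laplace:
  assumes z: "Re z > 0" and s: "Re s > 0"
  shows "has_bochner_integral lborel (\<lambda>x. truncated_power x (z - 1) * exp (- (s * of_real x)))
           (Gamma z * s powr (- z))"
proof -
  (* This choice makes the squared distance from s to c equal to c^2 - |s|^2. *)
  define c where "c = (cmod s)\<^sup>2 / Re s"
  have "s \<noteq> 0" using s by auto
  then have c: "c > 0" using s by (simp add: c_def)
  have "(cmod (of_real c - s))\<^sup>2 = c\<^sup>2 - 2 * (c * Re s) + (cmod s)\<^sup>2"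
    unfolding cmod_power2 by (simp add: power2_eq_square algebra_simps)
  also have "\<dots> = c\<^sup>2 - (cmod s)\<^sup>2" using s by (simp add: c_def)
  also have "\<dots> < c\<^sup>2" using \<open>s \<noteq> 0\<close> by simp
  finally have d: "cmod (of_real c - s) < c" using c by (simp add: power2_less_imp_less)
  define q where "q = (of_real c - s) / of_real c"
  have q: "cmod q < 1" using c d by (simp add: q_def norm_divide)
  define f where "f n x = (of_real c - s) ^ n / fact n * (truncated_power x (z + of_nat n - 1) * exp (- of_real (c * x)))"
    for n :: nat and x
  have f_int: "has_bochner_integral lborel (f n)
      (Gamma z * of_real c powr (- z) * (((- z) gchoose n) * (- q) ^ n))" (is "has_bochner_integral _ _ ?I") for n
  proof -
    have "has_bochner_integral lborel (f n) ((of_real c - s) ^ n / fact n * (Gamma (z + of_nat n) * of_real c powr (- (z + of_nat n))))"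
      unfolding f_def using z c
      by (intro has_bochner_integral_mult_right truncated_power_laplace_real) auto
    moreover have "Gamma (z + of_nat n) = Gamma z * pochhammer z n"
      using z by (rule Gamma_add_nat)
    moreover have "of_real c powr (- (z + of_nat n)) = of_real c powr (- z) / complex_of_real c ^ n"
      using c by (simp add: powr_diff powr_nat')
    moreover have "(of_real c - s) ^ n / fact n * (Gamma z * pochhammer z n * (of_real c powr (- z) / complex_of_real c ^ n)) = ?I"
      by (simp add: pochhammer_div_fact[symmetric] q_def power_divide)
    ultimately show ?thesis by (simp only:)
  qed
  have f_eq: "f n x = truncated_power x (z - 1) * exp (- of_real (c * x)) * (((of_real c - s) * of_real x) ^ n / fact n)" for n x
  proof -
    have "z + of_nat n - 1 = (z - 1) + of_nat n" by simp
    then show ?thesis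
      unfolding f_def by (simp only: truncated_power_add_nat power_mult_distrib) (simp add: mult_ac)
  qed
  have f_sums: "(\<lambda>n. f n x) sums (truncated_power x (z - 1) * exp (- (s * of_real x)))" for x
  proof -
    have "(\<lambda>n. f n x) sums (truncated_power x (z - 1) * exp (- of_real (c * x)) * exp ((of_real c - s) * of_real x))"
      unfolding f_eq using exp_converges[of "(of_real c - s) * of_real x"]
      by (intro sums_mult) (simp add: scaleR_conv_of_real field_simps)
    moreover have "exp (- of_real (c * x)) * exp ((of_real c - s) * of_real x) = exp (- (s * of_real x))"
      unfolding exp_add[symmetric] by (simp add: algebra_simps)
    ultimately show ?thesis by (simp only: mult.assoc)
  qed
  have summ: "AE x in lborel. summable (\<lambda>n. norm (f n x))"
  proof (rule AE_I2)
    fix x :: real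
    have "(\<lambda>n. norm (f n x)) = (\<lambda>n. norm (truncated_power x (z - 1) * exp (- of_real (c * x))) *
        norm (((of_real c - s) * of_real x) ^ n /\<^sub>R fact n))"
      by (simp add: f_eq norm_mult norm_divide norm_inverse divide_inverse_commute fun_eq_iff)
    then show "summable (\<lambda>n. norm (f n x))"
      by (metis summable_norm_exp summable_mult)
  qed
  have summ2: "summable (\<lambda>n. \<integral>x. norm (f n x) \<partial>lborel)"
  proof -
    (* The norms of the terms are the terms belonging to the exponent Re z and to the point
       c - |c - s|, so their integrals form a convergent binomial series as well. *)
    define r where "r = complex_of_real (Re z)"
    have r: "Re r > 0" using z by (simp add: r_def)
    have "complex_of_real (\<integral>x. norm (f n x) \<partial>lborel)
       = Gamma r * of_real c powr (- r) * (((- r) gchoose n) * (- of_real (cmod q)) ^ n)" (is "_ = ?I") for n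
    proof -
      have "complex_of_real (\<integral>x. norm (f n x) \<partial>lborel) = (\<integral>x. complex_of_real (norm (f n x)) \<partial>lborel)"
        by (rule integral_complex_of_real[symmetric])
      also have "\<dots> = (\<integral>x. of_real (cmod (of_real c - s)) ^ n / fact n * (truncated_power x (r + of_nat n - 1) * exp (- of_real (c * x))) \<partial>lborel)"
      proof (intro Bochner_Integration.integral_cong refl)
        fix x
        have "of_real (Re (z + of_nat n - 1)) = r + of_nat n - 1" by (simp add: r_def)
        moreover have "norm (exp (- complex_of_real (c * x))) = exp (- (c * x))" by simp
        ultimately show "complex_of_real (norm (f n x)) =
          of_real (cmod (of_real c - s)) ^ n / fact n * (truncated_power x (r + of_nat n - 1) * exp (- of_real (c * x)))"
          unfolding f_def norm_mult of_real_mult norm_truncated_power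
          by (simp add: norm_divide norm_power flip: exp_of_real)
      qed
      also have "\<dots> = of_real (cmod (of_real c - s)) ^ n / fact n * (Gamma (r + of_nat n) * of_real c powr (- (r + of_nat n)))"
        using r c by (intro has_bochner_integral_integral_eq has_bochner_integral_mult_right truncated_power_laplace_real) auto
      also have "Gamma (r + of_nat n) = Gamma r * pochhammer r n"
        using r by (rule Gamma_add_nat)
      also have "of_real c powr (- (r + of_nat n)) = of_real c powr (- r) / complex_of_real c ^ n"
        using c by (simp add: powr_diff powr_nat')
      also have "of_real (cmod (of_real c - s)) ^ n / fact n * (Gamma r * pochhammer r n * (of_real c powr (- r) / complex_of_real c ^ n)) = ?I"
        using c by (simp add: pochhammer_div_fact[symmetric] q_def power_divide norm_divide)
      finally show ?thesis .
    qed
    moreover have "summable (\<lambda>n. Gamma r * of_real c powr (- r) * (((- r) gchoose n) * (- of_real (cmod q)) ^ n))"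
      using q gen_binomial_complex[of "- of_real (cmod q)" "- r"]
      by (intro summable_mult) (auto intro: sums_summable)
    ultimately show ?thesis by (simp only: flip: summable_complex_of_real)
  qed
  have ints: "\<And>n. integrable lborel (f n)" "\<And>n. integral\<^sup>L lborel (f n) = Gamma z * of_real c powr (- z) * (((- z) gchoose n) * (- q) ^ n)"
    using f_int by (auto simp: has_bochner_integral_iff)
  have lim: "(\<lambda>x. truncated_power x (z - 1) * exp (- (s * of_real x))) = (\<lambda>x. \<Sum>n. f n x)"
    using f_sums by (auto simp: sums_iff)
  have "(\<lambda>n. integral\<^sup>L lborel (f n)) sums (Gamma z * of_real c powr (- z) * (1 + (- q)) powr (- z))"
    unfolding ints using q by (intro sums_mult gen_binomial_complex) simp
  then have "(\<integral>x. (\<Sum>n. f n x) \<partial>lborel) = Gamma z * of_real c powr (- z) * (1 + (- q)) powr (- z)"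
    using integral_suminf[OF ints(1) summ summ2] by (simp add: sums_iff)
  also have "1 + (- q) = s / of_real c"
    using c by (simp add: q_def field_simps)
  also have "Gamma z * of_real c powr (- z) * (s / of_real c) powr (- z) = Gamma z * (of_real c powr (- z) * (s / of_real c) powr (- z))"
    by simp
  also have "of_real c powr (- z) * (s / of_real c) powr (- z) = (of_real c * (s / of_real c)) powr (- z)"
    using c by (intro powr_times_real_left[symmetric])  auto
  also have "of_real c * (s / of_real c) = s" using c by simp
  finally show ?thesis
    using integrable_suminf[OF ints(1) summ summ2] unfolding lim has_bochner_integral_iff by simp
qed


section \<open>The complex exponential B-spline in the time domain\<close>

definition exp_spline :: "real \<Rightarrow> complex \<Rightarrow> real \<Rightarrow> complex" where
  "exp_spline a z x = of_real (exp (- (a * x))) / Gamma z *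
     (\<Sum>l. (-1) ^ l * (z gchoose l) * truncated_power (x - real l) (z - 1))"

lemma exp_spline_measurable [measurable]: "exp_spline a z \<in> borel_measurable borel"
  unfolding exp_spline_def[abs_def] by measurable

text \<open>Raising the parameter damps the function by an exponential factor. This is how the functions
  with \<open>a = 0\<close>, whose individual terms grow at infinity, are approximated by series of integrable
  terms.\<close>

lemma exp_spline_add: "exp_spline (a + e) z x = of_real (exp (- (e * x))) * exp_spline a z x"
  by (simp add: exp_spline_def distrib_right exp_add[symmetric] mult.assoc flip: of_real_mult exp_add)

lemma truncated_power_shift_eq_0: "x \<le> real l \<Longrightarrow> truncated_power (x - real l) w = 0"
  by (simp add: truncated_power_def)

lemma exp_spline_eq_sum:
  assumes "x \<le> real N"
  shows "exp_spline a z x = of_real (exp (- (a * x))) / Gamma z *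
     (\<Sum>l<N. (-1) ^ l * (z gchoose l) * truncated_power (x - real l) (z - 1))"
proof -
  have "truncated_power (x - real l) (z - 1) = 0" if "l \<notin> {..<N}" for l
    using that assms by (intro truncated_power_shift_eq_0) auto
  then show ?thesis
    unfolding exp_spline_def by (subst suminf_finite[of "{..<N}"]) auto
qed

lemma exp_spline_eq_0: "x \<le> 0 \<Longrightarrow> exp_spline a z x = 0"
  using exp_spline_eq_sum[of x 0] by simp

lemma truncated_power_laplace_shift:
  assumes z: "Re z > 0" and s: "Re s > 0"
  shows "has_bochner_integral lborel (\<lambda>x. truncated_power (x - t) (z - 1) * exp (- (s * of_real x)))
           (exp (- (s * of_real t)) * (Gamma z * s powr (- z)))"
proof -
  let ?h = "\<lambda>x. truncated_power x (z - 1) * exp (- (s * of_real x))"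
  have "has_bochner_integral lborel (\<lambda>x. ?h (x + - t)) (Gamma z * s powr (- z))"
    using truncated_power_laplace[OF z s] integrable_translate[of ?h "- t"] integral_translate[of ?h "- t"]
    by (simp add: has_bochner_integral_iff)
  then have "has_bochner_integral lborel (\<lambda>x. exp (- (s * of_real t)) * ?h (x + - t))
    (exp (- (s * of_real t)) * (Gamma z * s powr (- z)))"
    by (rule has_bochner_integral_mult_right)
  moreover have "exp (- (s * of_real t)) * ?h (x + - t) = truncated_power (x - t) (z - 1) * exp (- (s * of_real x))" for x
  proof -
    have "exp (- (s * of_real t)) * exp (- (s * of_real (x + - t))) = exp (- (s * of_real x))"
      unfolding exp_add[symmetric] by (simp add: algebra_simps)
    then show ?thesis by (simp add: mult.left_commute)
  qed
  ultimately show ?thesis by (simp only:)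
qed

text \<open>Both arguments lie strictly between \<open>- pi / 2\<close> and \<open>pi / 2\<close>, so their difference is the
  principal argument of the quotient.\<close>

lemma powr_divide_Re_pos:
  assumes w: "Re w > 0" and s: "Re s > 0"
  shows "(w / s) powr z = w powr z * s powr (- z)"
proof -
  have nz: "w \<noteq> 0" "s \<noteq> 0" using w s by auto
  have "Ln (w / s) = Ln w - Ln s"
  proof (rule Ln_unique)
    show "exp (Ln w - Ln s) = w / s" using nz by (simp add: exp_diff)
    show "- pi < Im (Ln w - Ln s)" "Im (Ln w - Ln s) \<le> pi"
      using Re_Ln_pos_lt_imp[OF w] Re_Ln_pos_lt_imp[OF s] by (auto simp: abs_less_iff)
  qed
  then show ?thesis
    using nz by (simp add: powr_def right_diff_distrib flip: exp_add)
qed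

text \<open>With \<open>s = a + \<i> \<omega>\<close>, the transform of the \<open>l\<close>-th term is
  \<open>(z gchoose l) * (- exp (- s)) ^ l * s powr (- z)\<close>. Since \<open>\<bar>exp (- s)\<bar> = exp (- a) < 1\<close>, the
  generalised binomial theorem sums these terms, absolutely, to
  \<open>(1 - exp (- s)) powr z * s powr (- z)\<close>.\<close>

lemma exp_spline_fourier_series:
  assumes a: "a > 0" and z: "Re z > 1"
  defines "s \<equiv> \<lambda>\<omega>. complex_of_real a + \<i> * complex_of_real \<omega>"
  defines "g \<equiv> \<lambda>\<omega> l x. 1 / Gamma z * ((-1) ^ l * (z gchoose l)) * (truncated_power (x - real l) (z - 1) * exp (- (s \<omega> * of_real x)))"
  shows "integrable lborel (\<lambda>x. \<Sum>l. g \<omega> l x)"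
    and "(\<integral>x. (\<Sum>l. g \<omega> l x) \<partial>lborel) = exp_spline_base a \<omega> powr z"
    and "(\<Sum>l. g \<omega> l x) = exp_spline a z x * exp (- (\<i> * complex_of_real \<omega> * complex_of_real x))"
proof -
  have s: "Re (s \<omega>) > 0" using a by (simp add: s_def)
  have z0: "Re z > 0" using z by simp
  have Gz: "Gamma z \<noteq> 0" by (rule Gamma_nonzero_Re_pos[OF z0])
  have gl: "has_bochner_integral lborel (g \<omega> l)
     (1 / Gamma z * ((-1) ^ l * (z gchoose l)) * (exp (- (s \<omega> * of_real (real l))) * (Gamma z * s \<omega> powr (- z))))" for l
    unfolding g_def by (intro has_bochner_integral_mult_right truncated_power_laplace_shift z0 s)
  have val: "1 / Gamma z * ((-1) ^ l * (z gchoose l)) * (exp (- (s \<omega> * of_real (real l))) * (Gamma z * s \<omega> powr (- z)))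
      = (z gchoose l) * (- exp (- s \<omega>)) ^ l * s \<omega> powr (- z)" for l
  proof -
    have "exp (- (s \<omega> * of_real (real l))) = exp (- s \<omega>) ^ l"
      by (simp flip: exp_of_nat_mult add: mult.commute)
    then show ?thesis using Gz by (simp add: power_minus[of "exp (- s \<omega>)"])
  qed
  note gl = gl[unfolded val]
  have g_int: "\<And>l. integrable lborel (g \<omega> l)"
    and g_val: "\<And>l. integral\<^sup>L lborel (g \<omega> l) = (z gchoose l) * (- exp (- s \<omega>)) ^ l * s \<omega> powr (- z)"
    using gl by (auto simp: has_bochner_integral_iff)
  have summ: "AE x in lborel. summable (\<lambda>l. norm (g \<omega> l x))"
  proof (rule AE_I2)
    fix x :: real
    have "g \<omega> l x = 0" if "l \<notin> {..<nat \<lceil>x\<rceil>}" for l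
    proof -
      have "x \<le> real l" using that by (simp add: not_less nat_le_iff ceiling_le_iff)
      then show ?thesis by (simp add: g_def truncated_power_shift_eq_0)
    qed
    then show "summable (\<lambda>l. norm (g \<omega> l x))"
      by (intro summable_finite[of "{..<nat \<lceil>x\<rceil>}"]) auto
  qed
  define h where "h t = norm (truncated_power t (z - 1) * exp (- (of_real a * of_real t)))" for t
  have summ2: "summable (\<lambda>l. \<integral>x. norm (g \<omega> l x) \<partial>lborel)"
  proof -
    have "(\<integral>x. norm (g \<omega> l x) \<partial>lborel) = (\<integral>x. h x \<partial>lborel) / norm (Gamma z) * norm ((z gchoose l) * of_real (exp (- a)) ^ l)" for l
    proof -
      have "norm (g \<omega> l x) = norm (z gchoose l) * exp (- a) ^ l / norm (Gamma z) * h (x + - real l)" for x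
      proof -
        have "exp (- a) ^ l * exp (- (a * (x - real l))) = exp (- (a * x))"
          by (simp add: algebra_simps flip: exp_of_nat_mult exp_add)
        then show ?thesis
          by (simp add: g_def h_def s_def norm_mult norm_divide norm_power mult_ac)
      qed
      then have "(\<integral>x. norm (g \<omega> l x) \<partial>lborel) = norm (z gchoose l) * exp (- a) ^ l / norm (Gamma z) * (\<integral>x. h x \<partial>lborel)"
        using integral_translate[of h "- real l"] by simp
      then show ?thesis by (simp add: norm_mult norm_power)
    qed
    moreover have "summable (\<lambda>l. norm ((z gchoose l) * complex_of_real (exp (- a)) ^ l))"
      using a by (intro abs_summable_in_conv_radius) (auto simp: conv_radius_gchoose)
    ultimately show ?thesis by (simp add: summable_mult)
  qed
  show "integrable lborel (\<lambda>x. \<Sum>l. g \<omega> l x)"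
    by (rule integrable_suminf[OF g_int summ summ2])
  have e1: "norm (exp (- s \<omega>)) < 1" using s by simp
  have "(\<lambda>l. integral\<^sup>L lborel (g \<omega> l)) sums ((1 + - exp (- s \<omega>)) powr z * s \<omega> powr (- z))"
    unfolding g_val using e1 by (intro sums_mult2 gen_binomial_complex) simp
  then have "(\<integral>x. (\<Sum>l. g \<omega> l x) \<partial>lborel) = (1 - exp (- s \<omega>)) powr z * s \<omega> powr (- z)"
    using integral_suminf[OF g_int summ summ2] by (simp add: sums_iff)
  also have "\<dots> = ((1 - exp (- s \<omega>)) / s \<omega>) powr z"
  proof (rule powr_divide_Re_pos[symmetric, OF _ s])
    show "Re (1 - exp (- s \<omega>)) > 0"
      using le_less_trans[OF complex_Re_le_cmod e1] by (simp del: Re_exp)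
  qed
  also have "(1 - exp (- s \<omega>)) / s \<omega> = exp_spline_base a \<omega>"
    using a by (simp add: exp_spline_base_def s_def)
  finally show "(\<integral>x. (\<Sum>l. g \<omega> l x) \<partial>lborel) = exp_spline_base a \<omega> powr z" .
  have sm: "summable (\<lambda>l. (-1) ^ l * (z gchoose l) * truncated_power (x - real l) (z - 1))"
  proof (rule summable_finite[of "{..<nat \<lceil>x\<rceil>}"])
    fix l assume "l \<notin> {..<nat \<lceil>x\<rceil>}"
    then have "x \<le> real l" by (simp add: not_less nat_le_iff ceiling_le_iff)
    then show "(-1) ^ l * (z gchoose l) * truncated_power (x - real l) (z - 1) = 0"
      by (simp add: truncated_power_shift_eq_0)
  qed simp
  have "g \<omega> l x = (exp (- (s \<omega> * of_real x)) / Gamma z) * ((-1) ^ l * (z gchoose l) * truncated_power (x - real l) (z - 1))" for l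
    by (simp add: g_def)
  then have "(\<Sum>l. g \<omega> l x) = (exp (- (s \<omega> * of_real x)) / Gamma z) * (\<Sum>l. (-1) ^ l * (z gchoose l) * truncated_power (x - real l) (z - 1))"
    by (simp only: suminf_mult[OF sm])
  moreover have "exp (- (s \<omega> * of_real x)) = of_real (exp (- (a * x))) * exp (- (\<i> * complex_of_real \<omega> * complex_of_real x))"
    by (simp add: s_def algebra_simps flip: exp_of_real exp_add)
  ultimately show "(\<Sum>l. g \<omega> l x) = exp_spline a z x * exp (- (\<i> * complex_of_real \<omega> * complex_of_real x))"
    by (simp add: exp_spline_def)
qed

lemma exp_spline_fourier:
  assumes a: "a > 0" and z: "Re z > 1"
  shows "integrable lborel (exp_spline a z)"
    and "fourier_integral (exp_spline a z) \<omega> = exp_spline_base a \<omega> powr z"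
  using exp_spline_fourier_series(1)[OF a z, of 0] exp_spline_fourier_series(2)[OF a z, of \<omega>]
  unfolding exp_spline_fourier_series(3)[OF a z] fourier_integral_def by simp_all

lemma norm_one_minus_exp_le:
  assumes "Re s \<ge> 0"
  shows "cmod (1 - exp (- s)) \<le> cmod s"
proof -
  have "cmod (exp (- 0) - exp (- s)) \<le> 1 * cmod (0 - s)"
  proof (rule field_differentiable_bound[of "{z. Re z \<ge> 0}" "\<lambda>z. exp (- z)" "\<lambda>z. - exp (- z)"])
    show "((\<lambda>z. exp (- z)) has_field_derivative - exp (- z)) (at z within {z. 0 \<le> Re z})" for z :: complex
      by (auto intro!: derivative_eq_intros)
  qed (use assms in \<open>auto simp: convex_halfspace_Re_ge\<close>)
  then show ?thesis by simp
qed

text \<open>The second bound is used uniformly in \<open>a\<close>: it combines \<open>1\<close> for small frequencies with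
  \<open>2 / \<bar>\<omega>\<bar>\<close> for large ones, the change taking place at \<open>\<bar>\<omega>\<bar> = 2\<close>.\<close>

lemma norm_exp_spline_base_le:
  assumes "a \<ge> 0"
  shows "cmod (exp_spline_base a \<omega>) \<le> 1" and "(cmod (exp_spline_base a \<omega>))\<^sup>2 \<le> 5 / (1 + \<omega>\<^sup>2)"
proof -
  define s where "s = complex_of_real a + \<i> * complex_of_real \<omega>"
  have s: "Re s \<ge> 0" "(cmod s)\<^sup>2 = a\<^sup>2 + \<omega>\<^sup>2" "s = 0 \<longleftrightarrow> a = 0 \<and> \<omega> = 0"
    using assms by (auto simp: s_def cmod_power2 complex_eq_iff)
  have b: "exp_spline_base a \<omega> = (if s = 0 then 1 else (1 - exp (- s)) / s)"
    by (simp add: exp_spline_base_def s_def[symmetric] s(3))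
  show 1: "cmod (exp_spline_base a \<omega>) \<le> 1"
    using norm_one_minus_exp_le[OF s(1)] by (auto simp: b norm_divide divide_le_eq)
  show "(cmod (exp_spline_base a \<omega>))\<^sup>2 \<le> 5 / (1 + \<omega>\<^sup>2)"
  proof (cases "\<omega>\<^sup>2 \<le> 4")
    case True
    have "(cmod (exp_spline_base a \<omega>))\<^sup>2 \<le> 1" using 1 by (simp add: power_le_one)
    also have "1 \<le> 5 / (1 + \<omega>\<^sup>2)" using True by (simp add: add_pos_nonneg le_divide_eq)
    finally show ?thesis .
  next
    case False
    then have "\<omega> \<noteq> 0" by auto
    then have "s \<noteq> 0" using s(3) by auto
    have "cmod (1 - exp (- s)) \<le> 1 + cmod (exp (- s))" using norm_triangle_ineq4[of 1 "exp (- s)"] by simp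
    also have "\<dots> \<le> 2" using s(1) by simp
    finally have "(cmod (1 - exp (- s)))\<^sup>2 \<le> 2\<^sup>2" by (intro power_mono) auto
    then have "(cmod (exp_spline_base a \<omega>))\<^sup>2 \<le> 4 / (cmod s)\<^sup>2"
      using \<open>s \<noteq> 0\<close> by (simp add: b norm_divide power_divide divide_right_mono)
    also have "\<dots> \<le> 4 / \<omega>\<^sup>2" using s(2) \<open>\<omega> \<noteq> 0\<close> by (intro divide_left_mono) (auto simp: add_nonneg_pos)
    also have "\<dots> \<le> 5 / (1 + \<omega>\<^sup>2)" using False \<open>\<omega> \<noteq> 0\<close> by (simp add: divide_simps add_nonneg_eq_0_iff add_pos_nonneg)
    finally show ?thesis .
  qed
qed

lemma norm_exp_spline_base_powr_le:
  assumes "a \<ge> 0" "Re z > 1"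
  shows "cmod (exp_spline_base a \<omega> powr z) \<le> exp (\<bar>Im z\<bar> * pi) * sqrt (5 / (1 + \<omega>\<^sup>2))"
proof -
  let ?b = "exp_spline_base a \<omega>"
  have "- Im z * Arg ?b \<le> \<bar>Im z\<bar> * \<bar>Arg ?b\<bar>" 
    by (metis abs_ge_self abs_minus_cancel abs_mult mult_minus_left)
  also have "\<dots> \<le> \<bar>Im z\<bar> * pi"
    using Arg_le_pi[of ?b] mpi_less_Arg[of ?b] by (intro mult_left_mono) (auto simp: abs_le_iff)
  finally have 1: "exp (- Im z * Arg ?b) \<le> exp (\<bar>Im z\<bar> * pi)" by simp
  have "cmod ?b powr Re z \<le> cmod ?b powr 1"
    using norm_exp_spline_base_le(1)[OF assms(1)] assms(2) by (intro powr_mono') auto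
  also have "\<dots> = cmod ?b" by simp
  also have "\<dots> \<le> sqrt (5 / (1 + \<omega>\<^sup>2))"
    using norm_exp_spline_base_le(2)[OF assms(1)] by (intro real_le_rsqrt)
  finally have "cmod ?b powr Re z * exp (- Im z * Arg ?b) \<le> sqrt (5 / (1 + \<omega>\<^sup>2)) * exp (\<bar>Im z\<bar> * pi)"
    using 1 by (intro mult_mono) auto
  then show ?thesis by (simp add: norm_powr_complex mult.commute)
qed

text \<open>Let \<open>s = a + \<i> \<omega>\<close>. If \<open>1 - exp (- s)\<close> is a nonpositive multiple of \<open>s\<close>, its real part is
  \<open>\<le> 0\<close>, which forces \<open>Re (exp (- s)) \<ge> 1\<close>; as \<open>\<bar>exp (- s)\<bar> \<le> 1\<close>, this means \<open>exp (- s) = 1\<close>.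
  Hence the principal power is continuous at every nonzero value of the base.\<close>

lemma exp_spline_base_not_nonpos_Reals:
  assumes a: "a \<ge> 0" and nz: "exp_spline_base a \<omega> \<noteq> 0"
  shows "exp_spline_base a \<omega> \<notin> \<real>\<^sub>\<le>\<^sub>0"
proof
  assume neg: "exp_spline_base a \<omega> \<in> \<real>\<^sub>\<le>\<^sub>0"
  define s where "s = complex_of_real a + \<i> * complex_of_real \<omega>"
  have b: "exp_spline_base a \<omega> = (1 - exp (- s)) / s" and "s \<noteq> 0"
    using neg by (auto simp: exp_spline_base_def s_def complex_eq_iff split: if_splits)
  from neg obtain r where r: "r \<le> 0" "exp_spline_base a \<omega> = complex_of_real r"
    by (auto simp: nonpos_Reals_def)
  then have eq: "1 - exp (- s) = complex_of_real r * s"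
    using \<open>s \<noteq> 0\<close> unfolding b by (simp add: field_simps)
  have "Re (1 - exp (- s)) = r * a" unfolding eq by (simp add: s_def)
  also have "\<dots> \<le> 0" using r a by (simp add: mult_le_0_iff)
  finally have Re1: "1 \<le> Re (exp (- s))" by simp
  have "cmod (exp (- s)) \<le> 1" using a by (simp add: s_def)
  then have norm1: "cmod (exp (- s)) = 1"
    using Re1 complex_Re_le_cmod[of "exp (- s)"] by linarith
  then have "Re (exp (- s)) = 1"
    using Re1 complex_Re_le_cmod[of "exp (- s)"] by linarith
  moreover from this have "Im (exp (- s)) = 0"
    using cmod_power2[of "exp (- s)"] norm1 by simp
  ultimately have "exp (- s) = 1"
    by (simp add: complex_eq_iff)
  then show False using nz b by simp
qed

lemma tendsto_exp_spline_base:
  fixes e :: "nat \<Rightarrow> real"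
  assumes e: "e \<longlonglongrightarrow> 0" and w: "\<omega> \<noteq> 0"
  shows "(\<lambda>n. exp_spline_base (a + e n) \<omega>) \<longlonglongrightarrow> exp_spline_base a \<omega>"
proof -
  have "complex_of_real (a + 0) + \<i> * complex_of_real \<omega> \<noteq> 0"
    using w by (simp add: complex_eq_iff)
  then have "(\<lambda>n. (1 - exp (- (complex_of_real (a + e n) + \<i> * complex_of_real \<omega>)))
             / (complex_of_real (a + e n) + \<i> * complex_of_real \<omega>))
    \<longlonglongrightarrow> (1 - exp (- (complex_of_real (a + 0) + \<i> * complex_of_real \<omega>)))
             / (complex_of_real (a + 0) + \<i> * complex_of_real \<omega>)"
    by (intro tendsto_intros e)
  then show ?thesis using w by (simp add: exp_spline_base_def)
qed

text \<open>The parameters \<open>a + 1 / Suc n\<close> are positive even for \<open>a = 0\<close>, so the damped functions have the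
  transforms computed above, and these are dominated by a square-integrable function that does not
  depend on \<open>n\<close>.\<close>

lemma exp_spline_has_L2_fourier:
  assumes a: "a \<ge> 0" and z: "Re z > 1"
  shows "has_L2_fourier (exp_spline a z) (\<lambda>\<omega>. exp_spline_base a \<omega> powr z)"
proof -
  define e where "e n = 1 / real (Suc n)" for n
  have e: "e \<longlonglongrightarrow> 0" "\<And>n. e n > 0"
    unfolding e_def using LIMSEQ_inverse_real_of_nat by (auto simp: inverse_eq_divide)
  have ae: "a + e n > 0" for n using a e(2)[of n] by linarith
  let ?u = "\<lambda>n. exp_spline (a + e n) z"
  have int: "integrable lborel (?u n)" for n by (rule exp_spline_fourier(1)[OF ae z])
  have four: "fourier_integral (?u n) \<omega> = exp_spline_base (a + e n) \<omega> powr z" for n \<omega>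
    by (rule exp_spline_fourier(2)[OF ae z])
  have lim: "(\<lambda>n. exp_spline_base (a + e n) \<omega> powr z) \<longlonglongrightarrow> exp_spline_base a \<omega> powr z" if "\<omega> \<noteq> 0" for \<omega>
    using exp_spline_base_not_nonpos_Reals[OF a, of \<omega>] z
    by (intro tendsto_powr_complex' tendsto_exp_spline_base e that tendsto_const) auto
  show ?thesis
  proof (rule has_L2_fourier_dominated[where u = ?u and H = "\<lambda>\<omega>. exp (\<bar>Im z\<bar> * pi) * sqrt (5 / (1 + \<omega>\<^sup>2))"])
    have [measurable]: "(\<lambda>\<omega>. exp_spline_base (a + e n) \<omega> powr z) \<in> borel_measurable borel" for n
      unfolding four[symmetric] by measurable
    (* At frequency 0 the parameter a = 0 is exceptional, so that value is put in by hand. *)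
    show "(\<lambda>\<omega>. exp_spline_base a \<omega> powr z) \<in> borel_measurable borel"
    proof (rule borel_measurable_LIMSEQ_metric)
      show "(\<lambda>\<omega>. if \<omega> = 0 then exp_spline_base a 0 powr z else exp_spline_base (a + e n) \<omega> powr z) \<in> borel_measurable borel" for n
        by measurable
      show "(\<lambda>n. if \<omega> = 0 then exp_spline_base a 0 powr z else exp_spline_base (a + e n) \<omega> powr z)
         \<longlonglongrightarrow> exp_spline_base a \<omega> powr z" for \<omega>
        using lim by (cases "\<omega> = 0") auto
    qed
    show "(\<lambda>n. ?u n x) \<longlonglongrightarrow> exp_spline a z x" for x
    proof -
      have "(\<lambda>n. of_real (exp (- (e n * x))) * exp_spline a z x) \<longlonglongrightarrow> of_real (exp (- (0 * x))) * exp_spline a z x"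
        by (intro tendsto_intros e)
      then show ?thesis by (simp add: exp_spline_add)
    qed
    show "cmod (?u n x) \<le> cmod (exp_spline a z x)" for n x
    proof (cases "x \<le> 0")
      case False
      then show ?thesis using e(2)[of n]
        unfolding exp_spline_add norm_mult by (intro mult_left_le_one_le) auto
    qed (simp add: exp_spline_eq_0)
    show "AE \<omega> in lborel. (\<lambda>n. fourier_integral (?u n) \<omega>) \<longlonglongrightarrow> exp_spline_base a \<omega> powr z"
      using AE_lborel_singleton[of 0] unfolding four by eventually_elim (rule lim)
    show "cmod (fourier_integral (?u n) \<omega>) \<le> exp (\<bar>Im z\<bar> * pi) * sqrt (5 / (1 + \<omega>\<^sup>2))" for n \<omega>
      unfolding four using ae[of n] z by (intro norm_exp_spline_base_powr_le) auto
    have "integrable lborel (\<lambda>\<omega>::real. inverse (1 + \<omega>\<^sup>2))"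
      using integrable_inverse_1_plus_square by (simp add: set_integrable_def)
    then have "integrable lborel (\<lambda>\<omega>::real. (exp (\<bar>Im z\<bar> * pi))\<^sup>2 * 5 * inverse (1 + \<omega>\<^sup>2))"
      by simp
    moreover have "(exp (\<bar>Im z\<bar> * pi) * sqrt (5 / (1 + \<omega>\<^sup>2)))\<^sup>2 = (exp (\<bar>Im z\<bar> * pi))\<^sup>2 * 5 * inverse (1 + \<omega>\<^sup>2)" for \<omega> :: real
      by (simp add: power_mult_distrib divide_inverse add_nonneg_nonneg)
    ultimately show "integrable lborel (\<lambda>\<omega>::real. (exp (\<bar>Im z\<bar> * pi) * sqrt (5 / (1 + \<omega>\<^sup>2)))\<^sup>2)" by simp
  qed (simp_all add: int)
qed

corollary exp_Bspline_AE:
  assumes "a \<ge> 0" and "Re z > 1"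
  shows "AE x in lborel. exp_Bspline a z x = exp_spline a z x" and "exp_Bspline a z \<in> borel_measurable borel"
proof -
  have B: "has_L2_fourier (exp_Bspline a z) (\<lambda>\<omega>. exp_spline_base a \<omega> powr z)"
    unfolding exp_Bspline_def using exp_spline_has_L2_fourier[OF assms]
    by (rule someI[where P = "\<lambda>f. has_L2_fourier f (\<lambda>\<omega>. exp_spline_base a \<omega> powr z)"])
  show "AE x in lborel. exp_Bspline a z x = exp_spline a z x"
    by (rule has_L2_fourier_unique[OF B exp_spline_has_L2_fourier[OF assms]])
  show "exp_Bspline a z \<in> borel_measurable borel"
    using B by (auto simp: has_L2_fourier_def square_integrable_def)
qed


section \<open>The beta integral and the Kummer function\<close>

lemma norm_truncated_power_le:
  assumes "Re w \<ge> 0" "X > 0" "u \<le> X"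
  shows "cmod (truncated_power u w) \<le> X powr Re w"
  using assms by (auto simp: truncated_power_eq_powr norm_powr_real_powr intro!: powr_mono2)

lemma integrable_truncated_power_product:
  assumes "Re z > 1" "Re \<zeta> > 1"
  shows "integrable lborel (\<lambda>u. truncated_power u (z - 1) * truncated_power (X - u) (\<zeta> - 1))"
proof (rule Bochner_Integration.integrable_bound)
  let ?C = "\<bar>X\<bar> powr (Re z - 1) * \<bar>X\<bar> powr (Re \<zeta> - 1)"
  show "integrable lborel (\<lambda>u. indicat_real {0..X} u * ?C)"
    by (intro integrable_mult_left integrable_real_indicator) (auto simp: emeasure_lborel_Icc_eq)
  show "AE u in lborel. norm (truncated_power u (z - 1) * truncated_power (X - u) (\<zeta> - 1))
     \<le> norm (indicat_real {0..X} u * ?C)"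
  proof (rule AE_I2)
    fix u
    show "norm (truncated_power u (z - 1) * truncated_power (X - u) (\<zeta> - 1)) \<le> norm (indicat_real {0..X} u * ?C)"
    proof (cases "0 < u \<and> u < X")
      case True
      have "norm (truncated_power u (z - 1) * truncated_power (X - u) (\<zeta> - 1)) \<le> X powr Re (z - 1) * X powr Re (\<zeta> - 1)"
        unfolding norm_mult using True assms by (intro mult_mono norm_truncated_power_le) auto
      then show ?thesis using True by simp
    qed (auto simp: truncated_power_def)
  qed
qed measurable

definition beta_integral :: "complex \<Rightarrow> complex \<Rightarrow> real \<Rightarrow> complex" where
  "beta_integral z \<zeta> X = (\<integral>u. truncated_power u (z - 1) * truncated_power (X - u) (\<zeta> - 1) \<partial>lborel)"

lemma beta_integral_scale:
  "beta_integral z \<zeta> X = truncated_power X (z + \<zeta> - 1) * beta_integral z \<zeta> 1"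
proof (cases "X > 0")
  case True
  have "beta_integral z \<zeta> X = X *\<^sub>R (\<integral>v. truncated_power (0 + X * v) (z - 1) * truncated_power (X - (0 + X * v)) (\<zeta> - 1) \<partial>lborel)"
    unfolding beta_integral_def using True by (subst lborel_integral_real_affine[of X _ 0]) auto
  also have "\<dots> = X *\<^sub>R (\<integral>v. (of_real X powr (z - 1) * of_real X powr (\<zeta> - 1)) *
     (truncated_power v (z - 1) * truncated_power (1 - v) (\<zeta> - 1)) \<partial>lborel)"
  proof (intro arg_cong[where f="\<lambda>x. X *\<^sub>R x"] Bochner_Integration.integral_cong refl)
    fix v
    have "X - (0 + X * v) = X * (1 - v)" by (simp add: algebra_simps)
    then show "truncated_power (0 + X * v) (z - 1) * truncated_power (X - (0 + X * v)) (\<zeta> - 1) =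
      (of_real X powr (z - 1) * of_real X powr (\<zeta> - 1)) * (truncated_power v (z - 1) * truncated_power (1 - v) (\<zeta> - 1))"
      using True by (simp only: truncated_power_mult add_0) (simp add: mult_ac)
  qed
  also have "\<dots> = (of_real X * (of_real X powr (z - 1) * of_real X powr (\<zeta> - 1))) * beta_integral z \<zeta> 1"
    unfolding beta_integral_def by (simp add: scaleR_conv_of_real)
  also have "of_real X * (of_real X powr (z - 1) * of_real X powr (\<zeta> - 1)) = truncated_power X (z + \<zeta> - 1)"
  proof -
    have "of_real X * (of_real X powr (z - 1) * of_real X powr (\<zeta> - 1)) = complex_of_real X powr 1 * of_real X powr (z + \<zeta> - 2)"
      using True by (simp flip: powr_add)
    also have "\<dots> = complex_of_real X powr (z + \<zeta> - 1)"
      unfolding powr_add[symmetric] by simp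
    finally show ?thesis using True by (simp add: truncated_power_eq_powr)
  qed
  finally show ?thesis .
next
  case False
  then have 0: "truncated_power u (z - 1) * truncated_power (X - u) (\<zeta> - 1) = 0" for u
    by (auto simp: truncated_power_def)
  have "truncated_power X (z + \<zeta> - 1) = 0" using False by (simp add: truncated_power_def)
  then show ?thesis unfolding beta_integral_def 0 by simp
qed

text \<open>Euler's argument: the double integral for \<open>Gamma z * Gamma \<zeta>\<close> is regrouped by the value \<open>X\<close> of
  the sum of the two variables, and the inner integral is then homogeneous in \<open>X\<close>.\<close>

lemma beta_integral_one:
  assumes z: "Re z > 0" and \<zeta>: "Re \<zeta> > 0"
  shows "Gamma z * Gamma \<zeta> = Gamma (z + \<zeta>) * beta_integral z \<zeta> 1"
proof -
  define p where "p u = truncated_power u (z - 1) * exp (- of_real u)" for u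
  define q where "q u = truncated_power u (\<zeta> - 1) * exp (- of_real u)" for u
  have p: "integrable lborel p" "integral\<^sup>L lborel p = Gamma z"
    using truncated_power_laplace_one[OF z] by (auto simp: has_bochner_integral_iff p_def[abs_def])
  have q: "integrable lborel q" "integral\<^sup>L lborel q = Gamma \<zeta>"
    using truncated_power_laplace_one[OF \<zeta>] by (auto simp: has_bochner_integral_iff q_def[abs_def])
  have [measurable]: "p \<in> borel_measurable borel" "q \<in> borel_measurable borel"
    using p(1) q(1) by auto
  have tr: "(\<integral>X. q (X - u) \<partial>lborel) = Gamma \<zeta>" "(\<integral>X. norm (q (X - u)) \<partial>lborel) = (\<integral>X. norm (q X) \<partial>lborel)"
     "integrable lborel (\<lambda>X. q (X - u))" for u
    using integral_translate[of q "- u"] integral_translate[of "\<lambda>x. norm (q x)" "- u"]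
      integrable_translate[OF q(1), of "- u"] q(2) by simp_all
  have int: "integrable (lborel \<Otimes>\<^sub>M lborel) (\<lambda>(u, X). p u * q (X - u))"
    using p(1) tr(3) by (intro lborel_pair.Fubini_integrable) (auto simp: norm_mult tr(2))
  have "Gamma z * Gamma \<zeta> = (\<integral>u. (\<integral>X. p u * q (X - u) \<partial>lborel) \<partial>lborel)"
    using p(2) by (simp add: tr(1))
  also have "\<dots> = (\<integral>X. (\<integral>u. p u * q (X - u) \<partial>lborel) \<partial>lborel)"
    by (rule lborel_pair.Fubini_integral[OF int, symmetric])
  also have "\<dots> = (\<integral>X. (truncated_power X (z + \<zeta> - 1) * exp (- of_real X)) * beta_integral z \<zeta> 1 \<partial>lborel)"
  proof (intro Bochner_Integration.integral_cong refl)
    fix X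
    have "p u * q (X - u) = exp (- of_real X) * (truncated_power u (z - 1) * truncated_power (X - u) (\<zeta> - 1))" for u
    proof -
      have "exp (- of_real u) * exp (- of_real (X - u)) = exp (- complex_of_real X)"
        unfolding exp_add[symmetric] by simp
      then show ?thesis by (simp add: p_def q_def mult_ac)
    qed
    then have "(\<integral>u. p u * q (X - u) \<partial>lborel) = exp (- of_real X) * beta_integral z \<zeta> X"
      by (simp add: beta_integral_def)
    then show "(\<integral>u. p u * q (X - u) \<partial>lborel) = (truncated_power X (z + \<zeta> - 1) * exp (- of_real X)) * beta_integral z \<zeta> 1"
      by (subst (asm) beta_integral_scale) (simp add: mult_ac)
  qed
  also have "\<dots> = Gamma (z + \<zeta>) * beta_integral z \<zeta> 1"
    using truncated_power_laplace_one[of "z + \<zeta>"] z \<zeta> by (simp add: has_bochner_integral_iff)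
  finally show ?thesis .
qed

lemma beta_integral_eq:
  assumes z: "Re z > 0" and \<zeta>: "Re \<zeta> > 0"
  shows "beta_integral z \<zeta> X = Gamma z * Gamma \<zeta> / Gamma (z + \<zeta>) * truncated_power X (z + \<zeta> - 1)"
  using beta_integral_one[OF z \<zeta>] Gamma_nonzero_Re_pos[of "z + \<zeta>"] z \<zeta>
  by (subst beta_integral_scale) (simp add: field_simps)

text \<open>Expanding the exponential produces beta integrals with first parameter \<open>z + m\<close>, and
  \<open>Gamma (z + m) / Gamma (z + \<zeta> + m)\<close> contributes the quotient of Pochhammer symbols in the Kummer
  series.\<close>

lemma kummer_integral:
  assumes z: "Re z > 1" and \<zeta>: "Re \<zeta> > 1"
  shows "has_bochner_integral lborel
    (\<lambda>u. of_real (exp (- (c * u))) * (truncated_power u (z - 1) * truncated_power (X - u) (\<zeta> - 1)))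
    (Gamma z * Gamma \<zeta> / Gamma (z + \<zeta>) * truncated_power X (z + \<zeta> - 1) * kummer_M z (z + \<zeta>) (of_real (- (c * X))))"
proof (cases "X > 0")
  case False
  then have 0: "truncated_power u (z - 1) * truncated_power (X - u) (\<zeta> - 1) = 0" for u
    by (auto simp: truncated_power_def)
  have "truncated_power X (z + \<zeta> - 1) = 0" using False by (simp add: truncated_power_def)
  then show ?thesis unfolding 0 by (simp add: has_bochner_integral_zero)
next
  case True
  define p where "p u = truncated_power u (z - 1) * truncated_power (X - u) (\<zeta> - 1)" for u
  have p: "integrable lborel p"
    unfolding p_def by (rule integrable_truncated_power_product[OF z \<zeta>])
  define f where "f m u = of_real ((- c) ^ m / fact m) *
     (truncated_power u (z + of_nat m - 1) * truncated_power (X - u) (\<zeta> - 1))" for m :: nat and u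
  have f_eq: "f m u = of_real ((- (c * u)) ^ m / fact m) * p u" for m u
  proof -
    have "truncated_power u (z + of_nat m - 1) = truncated_power u (z - 1) * of_real u ^ m"
      using truncated_power_add_nat[of u "z - 1" m] by (simp add: algebra_simps)
    moreover have "(- (c * u)) ^ m = (- c) ^ m * u ^ m" by (simp flip: power_mult_distrib)
    ultimately show ?thesis by (simp add: f_def p_def)
  qed
  have p0: "p u = 0" if "\<not> (0 < u \<and> u < X)" for u
    using that by (auto simp: p_def truncated_power_def)
  have f_le: "norm (f m u) \<le> (\<bar>c\<bar> * X) ^ m / fact m * norm (p u)" for m u
  proof (cases "0 < u \<and> u < X")
    case True
    have "\<bar>c * u\<bar> \<le> \<bar>c\<bar> * X" using True by (simp add: abs_mult mult_left_mono)
    then show ?thesis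
      unfolding f_eq norm_mult norm_of_real abs_divide power_abs abs_minus_cancel
      by (intro mult_right_mono) (auto intro!: divide_right_mono power_mono)
  qed (simp add: f_eq p0)
  have f_int: "integrable lborel (f m)" for m
  proof (rule Bochner_Integration.integrable_bound)
    show "integrable lborel (\<lambda>u. (\<bar>c\<bar> * X) ^ m / fact m * norm (p u))" using p by simp
    show "f m \<in> borel_measurable lborel" unfolding f_def by measurable
    show "AE u in lborel. norm (f m u) \<le> norm ((\<bar>c\<bar> * X) ^ m / fact m * norm (p u))"
      using f_le True by (auto simp: abs_mult)
  qed
  have f_val: "integral\<^sup>L lborel (f m) = (Gamma z * Gamma \<zeta> / Gamma (z + \<zeta>) * truncated_power X (z + \<zeta> - 1)) *
     (pochhammer z m / pochhammer (z + \<zeta>) m * (of_real (- (c * X)) ^ m / fact m))" for m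
  proof -
    have "integral\<^sup>L lborel (f m) = of_real ((- c) ^ m / fact m) * beta_integral (z + of_nat m) \<zeta> X"
      unfolding f_def beta_integral_def by (rule integral_mult_right_zero)
    also have "beta_integral (z + of_nat m) \<zeta> X = Gamma (z + of_nat m) * Gamma \<zeta> / Gamma ((z + \<zeta>) + of_nat m) * truncated_power X ((z + \<zeta> - 1) + of_nat m)"
      using z \<zeta> by (subst beta_integral_eq) (auto simp: algebra_simps)
    also have "Gamma ((z + \<zeta>) + of_nat m) = Gamma (z + \<zeta>) * pochhammer (z + \<zeta>) m"
      using z \<zeta> by (intro Gamma_add_nat) auto
    also have "Gamma (z + of_nat m) = Gamma z * pochhammer z m"
      using z by (intro Gamma_add_nat) auto
    finally have "integral\<^sup>L lborel (f m) = of_real ((- c) ^ m / fact m) *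
        (Gamma z * pochhammer z m * Gamma \<zeta> / (Gamma (z + \<zeta>) * pochhammer (z + \<zeta>) m) *
         (truncated_power X (z + \<zeta> - 1) * of_real X ^ m))"
      by (simp only: truncated_power_add_nat)
    moreover have "of_real (- (c * X)) ^ m = of_real ((- c) ^ m) * complex_of_real X ^ m"
      by (simp flip: power_mult_distrib)
    ultimately show ?thesis by (simp only:) (simp add: mult_ac)
  qed
  have exp_sums: "(\<lambda>m. f m u) sums (of_real (exp (- (c * u))) * p u)" for u
    unfolding f_eq using exp_converges[of "- (c * u)"]
    by (intro sums_mult2 sums_of_real) (simp add: field_simps)
  have summ: "AE u in lborel. summable (\<lambda>m. norm (f m u))"
  proof (rule AE_I2)
    fix u
    have "summable (\<lambda>m. (\<bar>c\<bar> * X) ^ m / fact m * norm (p u))"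
      using summable_exp[of "\<bar>c\<bar> * X"] by (intro summable_mult2) (simp add: divide_inverse_commute)
    then show "summable (\<lambda>m. norm (f m u))"
      by (rule summable_comparison_test'[where N = 0]) (use f_le in simp)
  qed
  have summ2: "summable (\<lambda>m. \<integral>u. norm (f m u) \<partial>lborel)"
  proof (rule summable_comparison_test'[where N = 0])
    show "summable (\<lambda>m. (\<bar>c\<bar> * X) ^ m / fact m * (\<integral>u. norm (p u) \<partial>lborel))"
      using summable_exp[of "\<bar>c\<bar> * X"] by (intro summable_mult2) (simp add: divide_inverse_commute)
    show "norm (\<integral>u. norm (f m u) \<partial>lborel) \<le> (\<bar>c\<bar> * X) ^ m / fact m * (\<integral>u. norm (p u) \<partial>lborel)" for m
    proof -
      have "(\<integral>u. norm (f m u) \<partial>lborel) \<le> (\<integral>u. (\<bar>c\<bar> * X) ^ m / fact m * norm (p u) \<partial>lborel)"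
        using f_int p f_le by (intro integral_mono) auto
      then show ?thesis by simp
    qed
  qed
  let ?K = "Gamma z * Gamma \<zeta> / Gamma (z + \<zeta>) * truncated_power X (z + \<zeta> - 1)"
  have K: "?K \<noteq> 0"
    using True z \<zeta> Gamma_nonzero_Re_pos[of z] Gamma_nonzero_Re_pos[of \<zeta>] Gamma_nonzero_Re_pos[of "z + \<zeta>"]
    by (simp add: truncated_power_def)
  have lim: "(\<lambda>u. of_real (exp (- (c * u))) * p u) = (\<lambda>u. \<Sum>m. f m u)"
    using exp_sums by (auto simp: sums_iff)
  have "(\<lambda>m. ?K * (pochhammer z m / pochhammer (z + \<zeta>) m * (of_real (- (c * X)) ^ m / fact m))) sums (\<integral>u. (\<Sum>m. f m u) \<partial>lborel)"
    using sums_integral[OF f_int summ summ2] unfolding f_val .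
  then have "(\<lambda>m. pochhammer z m / pochhammer (z + \<zeta>) m * (of_real (- (c * X)) ^ m / fact m)) sums ((\<integral>u. (\<Sum>m. f m u) \<partial>lborel) / ?K)"
    by (rule sums_mult_D[OF _ K])
  then have "kummer_M z (z + \<zeta>) (of_real (- (c * X))) = (\<integral>u. (\<Sum>m. f m u) \<partial>lborel) / ?K"
    unfolding kummer_M_def by (simp add: sums_iff)
  then have "(\<integral>u. (\<Sum>m. f m u) \<partial>lborel) = ?K * kummer_M z (z + \<zeta>) (of_real (- (c * X)))"
    using K by (simp add: field_simps)
  then show ?thesis
    using integrable_suminf[OF f_int summ summ2]
    unfolding p_def[symmetric] lim has_bochner_integral_iff by blast
qed


section \<open>The convolution of two splines\<close>

lemma complex_binomial_eq_gbinomial: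
  assumes "Re z > 1"
  shows "complex_binomial z l = z gchoose l"
proof -
  have "z + 1 \<notin> \<int>\<^sub>\<le>\<^sub>0" using assms by (auto simp: nonpos_Ints_def complex_eq_iff)
  moreover have "Gamma (of_nat l + 1 :: complex) = fact l"
    by (simp add: Gamma_fact add.commute)
  ultimately show ?thesis
    by (simp add: complex_binomial_def gbinomial_Gamma rGamma_inverse_Gamma field_simps)
qed

lemma exp_Bspline2_eq:
  assumes "a \<ge> 0" "b \<ge> 0" "Re z > 1" "Re \<zeta> > 1"
  shows "exp_Bspline2 a b z \<zeta> x = (\<integral>y. exp_spline a z y * exp_spline b \<zeta> (x - y) \<partial>lborel)"
  unfolding exp_Bspline2_def Defs.convolution_def
proof (rule integral_cong_AE)
  note [measurable] = exp_Bspline_AE(2)[OF assms(1,3)] exp_Bspline_AE(2)[OF assms(2,4)]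
  have "AE y in lborel. exp_Bspline b \<zeta> (x - y) = exp_spline b \<zeta> (x - y)"
    using AE_borel_affine[OF _ _ exp_Bspline_AE(1)[OF assms(2,4)], of "-1" x] by simp
  then show "AE y in lborel. exp_Bspline a z y * exp_Bspline b \<zeta> (x - y) = exp_spline a z y * exp_spline b \<zeta> (x - y)"
    using exp_Bspline_AE(1)[OF assms(1,3)] by eventually_elim simp
  show "(\<lambda>y. exp_Bspline a z y * exp_Bspline b \<zeta> (x - y)) \<in> borel_measurable lborel"
    by measurable
  show "(\<lambda>y. exp_spline a z y * exp_spline b \<zeta> (x - y)) \<in> borel_measurable lborel"
    by measurable
qed

lemma shifted_kummer_integral:
  assumes z: "Re z > 1" and \<zeta>: "Re \<zeta> > 1"
  shows "has_bochner_integral lborel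
    (\<lambda>y. of_real (exp (- (c * y))) * (truncated_power (y - s) (z - 1) * truncated_power (x - y - t) (\<zeta> - 1)))
    (of_real (exp (- (c * s))) * (Gamma z * Gamma \<zeta> / Gamma (z + \<zeta>) *
       truncated_power (x - (s + t)) (z + \<zeta> - 1) * kummer_M z (z + \<zeta>) (of_real (- (c * (x - (s + t)))))))"
    (is "has_bochner_integral _ ?f (_ * ?I)")
proof -
  define h where "h u = of_real (exp (- (c * u))) *
     (truncated_power u (z - 1) * truncated_power (x - (s + t) - u) (\<zeta> - 1))" for u
  have "has_bochner_integral lborel h ?I"
    unfolding h_def by (rule kummer_integral[OF z \<zeta>])
  then have "has_bochner_integral lborel (\<lambda>y. h (y + - s)) ?I"
    using integrable_translate[of h "- s"] integral_translate[of h "- s"] by (simp add: has_bochner_integral_iff)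
  then have "has_bochner_integral lborel (\<lambda>y. of_real (exp (- (c * s))) * h (y + - s)) (of_real (exp (- (c * s))) * ?I)"
    by (rule has_bochner_integral_mult_right)
  moreover have "of_real (exp (- (c * s))) * h (y + - s) = ?f y" for y
  proof -
    have "of_real (exp (- (c * s))) * of_real (exp (- (c * (y + - s)))) = complex_of_real (exp (- (c * y)))"
      unfolding of_real_mult[symmetric] exp_add[symmetric] by (simp add: algebra_simps)
    moreover have "x - (s + t) - (y + - s) = x - y - t" by simp
    ultimately show ?thesis by (simp only: h_def mult.assoc[symmetric]) simp
  qed
  ultimately show ?thesis by (simp only:)
qed

text \<open>The product vanishes unless \<open>0 < y < x\<close>, and there all terms with an index \<open>\<ge> x\<close> are zero, so
  that the convolution is an integral of a finite double sum.\<close>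

lemma exp_spline_product:
  fixes x y :: real
  assumes N: "x \<le> real N"
  shows "exp_spline a z y * exp_spline b \<zeta> (x - y) =
    (\<Sum>l<N. \<Sum>m<N. of_real (exp (- (b * x))) / (Gamma z * Gamma \<zeta>) * ((-1) ^ (l + m) * ((z gchoose l) * (\<zeta> gchoose m))) *
       (of_real (exp (- ((a - b) * y))) * (truncated_power (y - real l) (z - 1) * truncated_power (x - y - real m) (\<zeta> - 1))))"
    (is "_ = (\<Sum>l<N. \<Sum>m<N. ?t l m)")
proof (cases "0 < y \<and> y < x")
  case True
  have e: "exp (- (a * y)) * exp (- (b * (x - y))) = exp (- (b * x)) * exp (- ((a - b) * y))"
    unfolding exp_add[symmetric] by (simp add: algebra_simps)
  define A where "A l = (-1) ^ l * (z gchoose l) * truncated_power (y - real l) (z - 1)" for l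
  define B where "B m = (-1) ^ m * (\<zeta> gchoose m) * truncated_power (x - y - real m) (\<zeta> - 1)" for m
  have "exp_spline a z y * exp_spline b \<zeta> (x - y) =
     (of_real (exp (- (a * y))) / Gamma z * (\<Sum>l<N. A l)) * (of_real (exp (- (b * (x - y)))) / Gamma \<zeta> * (\<Sum>m<N. B m))"
    using True N by (subst (1 2) exp_spline_eq_sum[of _ N]) (auto simp: A_def B_def)
  also have "\<dots> = of_real (exp (- (a * y)) * exp (- (b * (x - y)))) / (Gamma z * Gamma \<zeta>) * (\<Sum>l<N. \<Sum>m<N. A l * B m)"
    by (simp add: sum_product)
  also have "\<dots> = (\<Sum>l<N. \<Sum>m<N. ?t l m)"
    unfolding sum_distrib_left e by (intro sum.cong refl) (simp add: A_def B_def power_add)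
  finally show ?thesis .
next
  case False
  then have "exp_spline a z y * exp_spline b \<zeta> (x - y) = 0"
    by (auto simp: exp_spline_eq_0 not_less)
  moreover have "?t l m = 0" for l m
    using False by (auto simp: truncated_power_def)
  ultimately show ?thesis by (simp only: sum.neutral_const)
qed

theorem mainTheorem4:
  fixes a b :: real and z \<zeta> :: complex
  assumes "a \<ge> 0" and "b \<ge> 0" and "a \<noteq> 0 \<or> b \<noteq> 0"
    and "Re z > 1" and "Re \<zeta> > 1"
  shows "\<forall>x::real. exp_Bspline2 a b z \<zeta> x =
    1 / Gamma (z + \<zeta>) *
    (\<Sum>k::nat.
       (\<Sum>l=0..k. complex_binomial z l * complex_binomial \<zeta> (k - l)
                    * complex_of_real (exp (- (real l * (a - b)))))
       * (-1) ^ k * complex_of_real (exp (- (b * x)))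
       * kummer_M z (z + \<zeta>) (complex_of_real (- ((a - b) * (x - real k))))
       * truncated_power (x - real k) (z + \<zeta> - 1))"
proof
  fix x :: real
  note z = \<open>Re z > 1\<close> and \<zeta> = \<open>Re \<zeta> > 1\<close>
  define N where "N = nat \<lceil>x\<rceil>"
  have N: "x \<le> real N" unfolding N_def by linarith
  have Gnz: "Gamma z \<noteq> 0" "Gamma \<zeta> \<noteq> 0" using z \<zeta> by (auto intro!: Gamma_nonzero_Re_pos)
  define Q where "Q k = kummer_M z (z + \<zeta>) (complex_of_real (- ((a - b) * (x - real k))))
       * truncated_power (x - real k) (z + \<zeta> - 1)" for k
  define c where "c l = z gchoose l" for l
  define d where "d l = \<zeta> gchoose l" for l
  have Q0: "Q k = 0" if "k \<ge> N" for k
    using that N unfolding Q_def by (subst truncated_power_shift_eq_0) auto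
  define g where "g l m = complex_of_real (exp (- (b * x))) / Gamma (z + \<zeta>) *
    ((c l * d m * complex_of_real (exp (- (real l * (a - b))))) * (-1) ^ (l + m) * Q (l + m))" for l m
  let ?h = "\<lambda>l m y. of_real (exp (- (b * x))) / (Gamma z * Gamma \<zeta>) * ((-1) ^ (l + m) * (c l * d m)) *
       (of_real (exp (- ((a - b) * y))) * (truncated_power (y - real l) (z - 1) * truncated_power (x - y - real m) (\<zeta> - 1)))"
  have h: "has_bochner_integral lborel (?h l m) (g l m)" for l m
  proof -
    have "g l m = of_real (exp (- (b * x))) / (Gamma z * Gamma \<zeta>) * ((-1) ^ (l + m) * (c l * d m)) *
      (of_real (exp (- ((a - b) * real l))) * (Gamma z * Gamma \<zeta> / Gamma (z + \<zeta>) *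
       truncated_power (x - (real l + real m)) (z + \<zeta> - 1) * kummer_M z (z + \<zeta>) (of_real (- ((a - b) * (x - (real l + real m)))))))"
      using Gnz by (simp add: g_def Q_def mult_ac)
    then show ?thesis
      by (simp only:) (intro has_bochner_integral_mult_right shifted_kummer_integral z \<zeta>)
  qed
  (* Q vanishes from N on, so the square of indices may be cut down to the triangle l + m < N,
     which is then summed along its diagonals. *)
  have "exp_Bspline2 a b z \<zeta> x = (\<integral>y. (\<Sum>l<N. \<Sum>m<N. ?h l m y) \<partial>lborel)"
    unfolding exp_Bspline2_eq[OF assms(1,2) z \<zeta>] exp_spline_product[OF N] c_def d_def ..
  also have "\<dots> = (\<Sum>l<N. \<Sum>m<N. g l m)"
    by (intro has_bochner_integral_integral_eq has_bochner_integral_sum h)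
  also have "\<dots> = (\<Sum>(l, m)\<in>{..<N} \<times> {..<N}. g l m)"
    by (simp add: sum.cartesian_product)
  also have "\<dots> = (\<Sum>(l, m)\<in>{(l, m). l + m < N}. g l m)"
  proof (rule sum.mono_neutral_right)
    show "\<forall>p\<in>{..<N} \<times> {..<N} - {(l, m). l + m < N}. (case p of (l, m) \<Rightarrow> g l m) = 0"
    proof
      fix p assume p: "p \<in> {..<N} \<times> {..<N} - {(l, m). l + m < N}"
      obtain l m where "p = (l, m)" by (cases p)
      then show "(case p of (l, m) \<Rightarrow> g l m) = 0"
        using p Q0[of "l + m"] by (simp add: g_def)
    qed
  qed auto
  also have "\<dots> = (\<Sum>k<N. \<Sum>l\<le>k. g l (k - l))"
    by (rule sum.triangle_reindex)
  also have "\<dots> = (\<Sum>k<N. 1 / Gamma (z + \<zeta>) * ((\<Sum>l=0..k. c l * d (k - l) * complex_of_real (exp (- (real l * (a - b)))))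
       * (-1) ^ k * complex_of_real (exp (- (b * x))) * Q k))"
  proof (intro sum.cong refl)
    fix k
    have "(\<Sum>l\<le>k. g l (k - l)) = (\<Sum>l\<le>k. 1 / Gamma (z + \<zeta>) * ((c l * d (k - l) * complex_of_real (exp (- (real l * (a - b)))))
       * (-1) ^ k * complex_of_real (exp (- (b * x))) * Q k))"
      by (intro sum.cong refl) (simp add: g_def)
    also have "\<dots> = 1 / Gamma (z + \<zeta>) * ((\<Sum>l=0..k. c l * d (k - l) * complex_of_real (exp (- (real l * (a - b)))))
       * (-1) ^ k * complex_of_real (exp (- (b * x))) * Q k)"
      by (simp only: sum_distrib_left sum_distrib_right atMost_atLeast0)
    finally show "(\<Sum>l\<le>k. g l (k - l)) = 1 / Gamma (z + \<zeta>) * ((\<Sum>l=0..k. c l * d (k - l) * complex_of_real (exp (- (real l * (a - b)))))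
       * (-1) ^ k * complex_of_real (exp (- (b * x))) * Q k)" .
  qed
  also have "\<dots> = 1 / Gamma (z + \<zeta>) * (\<Sum>k. (\<Sum>l=0..k. c l * d (k - l) * complex_of_real (exp (- (real l * (a - b)))))
       * (-1) ^ k * complex_of_real (exp (- (b * x))) * Q k)"
    unfolding sum_distrib_left[symmetric]
    by (subst suminf_finite[of "{..<N}"]) (auto simp: Q0 not_less)
  finally show "exp_Bspline2 a b z \<zeta> x = 1 / Gamma (z + \<zeta>) *
    (\<Sum>k::nat.
       (\<Sum>l=0..k. complex_binomial z l * complex_binomial \<zeta> (k - l)
                    * complex_of_real (exp (- (real l * (a - b)))))
       * (-1) ^ k * complex_of_real (exp (- (b * x)))
       * kummer_M z (z + \<zeta>) (complex_of_real (- ((a - b) * (x - real k))))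
       * truncated_power (x - real k) (z + \<zeta> - 1))"
    by (simp only: complex_binomial_eq_gbinomial[OF z] complex_binomial_eq_gbinomial[OF \<zeta>] c_def d_def Q_def mult.assoc)
qed

end
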